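(* Let $k\ge1$ be an integer, $C\ge 1$, and let $E\subset\mathbb{H}^k$ be $C$-Ahlfors regular. Assume that there are $\theta>0$, $C_1\ge 1$, and $\gamma_1:(0,1)\to(0,+\infty)$ such that for each $p\in E$, $r>0$, there is $\widetilde{E}\in\operatorname{BWGL}(C_1,\gamma_1)$ which satisfies $$\mathcal{H}^{2k+1}(E\cap\widetilde{E}\cap B(p,r))\ge\theta r^{2k+1}.$$ Then $E\in\operatorname{BWGL}(C,\gamma)$ for some $\gamma:(0,1)\to(0,+\infty)$ depending only on $C$, $\theta$, $C_1$ and $\gamma_1$ (the integer $k$ being fixed).
   Context: Heisenberg group. Fix an integer $k\ge 1$. $\mathbb{H}^k=\mathbb{R}^{2k}\times\mathbb{R}$ with group law $(v,t)\cdot(v',t')=(v+v',\,t+t'+\omega(v,v')/2)$, where $\omega(v,v')=\sum_{j=1}^k (v_jv'_{j+k}-v_{j+k}v'_j)$. The Korányi norm is $\|(v,t)\|=(|v|^4+16t^2)^{1/4}$ ($|\cdot|$ Euclidean) and the distance is $d(p,q)=\|q^{-1}\cdot p\|$. $B(p,r)=\{q: d(p,q)<r\}$. All balls, $\operatorname{dist}$, and Hausdorff measures $\mathcal{H}^s$ are with respect to $d$. Ahlfors regularity. For $C\ge1$, $E\subset\mathbb{H}^k$ is $C$-Ahlfors regular if $E$ is closed and $C^{-1}r^{2k+1}\le\mathcal{H}^{2k+1}(E\cap B(p,r))\le C r^{2k+1}$ for all $p\in E$, $r>0$. Carleson sets. For $E$ Ahlfors regular and $\gamma_0>0$, a $\gamma_0$-Carleson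 set is a measurable set $A\subset E\times(0,+\infty)$ with $\int_0^r\int_{E\cap B(p,r)}\chi_A(q,s)\,d\mathcal{H}^{2k+1}(q)\,\frac{ds}{s}\le\gamma_0 r^{2k+1}$ for all $p\in E$, $r>0$. Bilateral beta-numbers. Let $\mathcal{P}$ be the set of all affine hyperplanes of $\mathbb{H}^k$ identified with the vector space $\mathbb{R}^{2k+1}$. For $p\in E$, $s>0$, $$b\beta_E(p,s)=s^{-1}\inf_{P\in\mathcal{P}}\Big\{\sup_{q\in B(p,s)\cap E}\operatorname{dist}(q,P)+\sup_{q\in B(p,s)\cap P}\operatorname{dist}(q,E)\Big\},$$ with the supremum over the empty set equal to $0$. For $C\ge1$ and $\gamma:(0,1)\to(0,+\infty)$, $\operatorname{BWGL}(C,\gamma)$ is the class of $C$-Ahlfors regular sets $E\subset\mathbb{H}^k$ such that for each $\epsilon\in(0,1)$ the set $\{(p,s)\in E\times(0,+\infty): b\beta_E(p,s)>\epsilon\}$ is $\gamma(\epsilon)$-Carleson. *)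

theory Defs
  imports "HOL-Analysis.Analysis"
begin

section \<open>Hausdorff measures on a metric space\<close>

text \<open>
  No normalising constant is used: a covering set \<open>U\<close> contributes \<open>(diameter U)\<^sup>s\<close>.
  The covering sets have to be bounded because \<^const>\<open>diameter\<close> is only meaningful for bounded sets.
  The definition is intended for \<open>s > 0\<close>; for \<open>s = 0\<close> the convention \<open>0 powr 0 = 0\<close> does not
  produce the counting measure.
\<close>

definition hausdorff_content :: "real \<Rightarrow> real \<Rightarrow> 'a::metric_space set \<Rightarrow> ennreal" where
  "hausdorff_content s \<delta> A =
     (INF U \<in> {U :: nat \<Rightarrow> 'a set. A \<subseteq> (\<Union>i. U i) \<and> (\<forall>i. bounded (U i) \<and> diameter (U i) \<le> \<delta>)}.
        \<Sum>i. ennreal (diameter (U i) powr s))"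

definition hausdorff_outer :: "real \<Rightarrow> 'a::metric_space set \<Rightarrow> ennreal" where
  "hausdorff_outer s A = (SUP \<delta> \<in> {0<..}. hausdorff_content s \<delta> A)"

definition hausdorff_measure :: "real \<Rightarrow> 'a::metric_space measure" where
  "hausdorff_measure s = measure_of UNIV (sets borel) (hausdorff_outer s)"

text \<open>
  \<^const>\<open>measure_of\<close> returns the zero measure unless the given set function is countably additive.
  We therefore show that Borel sets are Caratheodory measurable; the outcome is
  \<open>emeasure_hausdorff_measure\<close> below.
\<close>

lemma hausdorff_content_mono: "A \<subseteq> B \<Longrightarrow> hausdorff_content s \<delta> A \<le> hausdorff_content s \<delta> B"
  unfolding hausdorff_content_def by (rule INF_superset_mono) auto

lemma hausdorff_content_antimono:
  "\<delta> \<le> \<delta>' \<Longrightarrow> hausdorff_content s \<delta>' A \<le> hausdorff_content s \<delta> A"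
  unfolding hausdorff_content_def by (rule INF_superset_mono) (auto intro: order_trans)

lemma hausdorff_content_le_outer: "\<delta> > 0 \<Longrightarrow> hausdorff_content s \<delta> A \<le> hausdorff_outer s A"
  unfolding hausdorff_outer_def by (rule SUP_upper) auto

lemma hausdorff_outer_mono: "A \<subseteq> B \<Longrightarrow> hausdorff_outer s A \<le> hausdorff_outer s B"
  unfolding hausdorff_outer_def by (rule SUP_mono) (blast intro: hausdorff_content_mono)

lemma hausdorff_outer_empty: "hausdorff_outer s {} = 0"
proof -
  have "hausdorff_content s \<delta> {} \<le> (\<Sum>i::nat. ennreal (diameter ({}::'a set) powr s))" if "\<delta> > 0" for \<delta>
    unfolding hausdorff_content_def by (rule INF_lower2[of "\<lambda>_. {}"]) (use that in auto)
  then have "hausdorff_content s \<delta> ({}::'a set) = 0" if "\<delta> > 0" for \<delta>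
    using that by simp
  then show ?thesis
    unfolding hausdorff_outer_def by (subst SUP_cong[where D = "\<lambda>_. 0"]) auto
qed

lemma hausdorff_content_subadd:
  "hausdorff_content s \<delta> (\<Union>i. A i) \<le> (\<Sum>i. hausdorff_content s \<delta> (A i))"
proof (cases "\<exists>i. hausdorff_content s \<delta> (A i) = top")
  case True
  then obtain i where "hausdorff_content s \<delta> (A i) = top" by blast
  moreover have "hausdorff_content s \<delta> (A i) \<le> (\<Sum>i. hausdorff_content s \<delta> (A i))"
    using sum_le_suminf[OF summableI, of "{i}" "\<lambda>i. hausdorff_content s \<delta> (A i)"] by auto
  ultimately show ?thesis by (simp add: top.extremum_unique)
next
  case False
  show ?thesis
  proof (rule ennreal_le_epsilon)
    fix e :: real assume e: "e > 0"
    have "\<exists>U. A i \<subseteq> (\<Union>j::nat. U j) \<and> (\<forall>j. bounded (U j) \<and> diameter (U j) \<le> \<delta>) \<and>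
        (\<Sum>j. ennreal (diameter (U j) powr s)) < hausdorff_content s \<delta> (A i) + ennreal (e * (1/2) ^ Suc i)" for i
    proof -
      have "hausdorff_content s \<delta> (A i) < hausdorff_content s \<delta> (A i) + ennreal (e * (1/2) ^ Suc i)"
        using False e ennreal_add_less_top
        by (cases "hausdorff_content s \<delta> (A i)") (auto simp flip: ennreal_plus intro!: ennreal_lessI add_nonneg_pos)
      then show ?thesis
        unfolding hausdorff_content_def INF_less_iff by blast
    qed
    then obtain U where U: "\<And>i. A i \<subseteq> (\<Union>j::nat. U i j)"
        "\<And>i j. bounded (U i j)" "\<And>i j. diameter (U i j) \<le> \<delta>"
        "\<And>i. (\<Sum>j. ennreal (diameter (U i j) powr s)) < hausdorff_content s \<delta> (A i) + ennreal (e * (1/2) ^ Suc i)"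
      by metis
    define V where "V n = (case prod_decode n of (i, j) \<Rightarrow> U i j)" for n
    have "hausdorff_content s \<delta> (\<Union>i. A i) \<le> (\<Sum>n. ennreal (diameter (V n) powr s))"
      unfolding hausdorff_content_def
    proof (rule INF_lower, clarsimp, intro conjI allI)
      have "x \<in> (\<Union>n. V n)" if xA: "x \<in> A i" for i x
      proof -
        obtain j where "x \<in> U i j" using subsetD[OF U(1)[of i] xA] by blast
        then have "x \<in> V (prod_encode (i, j))" by (simp add: V_def)
        then show ?thesis by blast
      qed
      then show "\<Union> (range A) \<subseteq> \<Union> (range V)" by blast
    qed (auto simp: V_def U split: prod.split)
    also have "\<dots> = (\<Sum>n. (\<lambda>(i, j). ennreal (diameter (U i j) powr s)) (prod_decode n))"
      by (intro suminf_cong) (auto simp: V_def split: prod.split)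
    also have "\<dots> = (\<Sum>i. \<Sum>j. ennreal (diameter (U i j) powr s))"
      by (rule suminf_ennreal_2dimen) simp
    also have "\<dots> \<le> (\<Sum>i. hausdorff_content s \<delta> (A i) + ennreal (e * (1/2) ^ Suc i))"
      by (intro suminf_le summableI less_imp_le[OF U(4)])
    also have "\<dots> = (\<Sum>i. hausdorff_content s \<delta> (A i)) + (\<Sum>i. ennreal (e * (1/2) ^ Suc i))"
      by (rule suminf_add[OF summableI summableI, symmetric])
    also have "(\<Sum>i. ennreal (e * (1/2) ^ Suc i)) = ennreal e"
      using sums_mult[OF power_half_series, of e] e by (intro suminf_ennreal_eq) auto
    finally show "hausdorff_content s \<delta> (\<Union>i. A i) \<le> (\<Sum>i. hausdorff_content s \<delta> (A i)) + ennreal e" .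
  qed
qed

lemma hausdorff_outer_subadd: "hausdorff_outer s (\<Union>i. A i) \<le> (\<Sum>i. hausdorff_outer s (A i))"
  unfolding hausdorff_outer_def[of s "\<Union>i. A i"]
proof (rule SUP_least)
  fix \<delta> :: real assume "\<delta> \<in> {0<..}"
  then have "(\<Sum>i. hausdorff_content s \<delta> (A i)) \<le> (\<Sum>i. hausdorff_outer s (A i))"
    by (intro suminf_le summableI hausdorff_content_le_outer) auto
  with hausdorff_content_subadd show "hausdorff_content s \<delta> (\<Union>i. A i) \<le> (\<Sum>i. hausdorff_outer s (A i))"
    by (rule order_trans)
qed

lemma outer_measure_space_hausdorff:
  "outer_measure_space UNIV (hausdorff_outer s :: 'a::metric_space set \<Rightarrow> ennreal)"
  unfolding outer_measure_space_def positive_def increasing_def countably_subadditive_def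
  using hausdorff_outer_empty hausdorff_outer_mono hausdorff_outer_subadd by blast

lemma hausdorff_outer_Un: "hausdorff_outer s (A \<union> B) \<le> hausdorff_outer s A + hausdorff_outer s B"
proof -
  have "subadditive UNIV (hausdorff_outer s :: 'a set \<Rightarrow> ennreal)"
    using outer_measure_space_hausdorff[of s, where 'a='a]
    by (intro ring_of_sets.countably_subadditive_subadditive)
       (auto simp: outer_measure_space_def ring_of_sets_iff)
  then have "hausdorff_outer s (A \<union> (B - A)) \<le> hausdorff_outer s A + hausdorff_outer s (B - A)"
    unfolding subadditive_def by blast
  also have "\<dots> \<le> hausdorff_outer s A + hausdorff_outer s B"
    by (intro add_left_mono hausdorff_outer_mono) auto
  finally show ?thesis by simp
qed

lemma hausdorff_outer_separated:
  assumes s: "s \<ge> 0" and e: "e > 0" and sep: "\<And>x y. x \<in> A \<Longrightarrow> y \<in> B \<Longrightarrow> dist x y \<ge> e"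
  shows "hausdorff_outer s A + hausdorff_outer s B \<le> hausdorff_outer s (A \<union> B)"
proof -
  have content: "hausdorff_content s \<delta> A + hausdorff_content s \<delta> B \<le> hausdorff_content s \<delta> (A \<union> B)"
    if \<delta>: "\<delta> < e" for \<delta>
    unfolding hausdorff_content_def[of s \<delta> "A \<union> B"]
  proof (rule INF_greatest, clarsimp)
    fix U :: "nat \<Rightarrow> 'a set"
    assume U: "A \<subseteq> \<Union> (range U)" "B \<subseteq> \<Union> (range U)" "\<forall>i. bounded (U i) \<and> diameter (U i) \<le> \<delta>"
    have sub: "bounded (U i \<inter> X)" "diameter (U i \<inter> X) \<le> diameter (U i)" for i X
      using U(3) by (auto intro!: diameter_subset intro: bounded_subset)
    have le: "diameter (U i \<inter> X) \<le> \<delta>" for i X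
      using sub(2) U(3) order_trans by blast
    have nn: "diameter (U i \<inter> X) \<ge> 0" for i X
      using sub(1) by (rule diameter_ge_0)
    have A: "hausdorff_content s \<delta> A \<le> (\<Sum>i. ennreal (diameter (U i \<inter> A) powr s))"
      unfolding hausdorff_content_def
      using U sub le by (intro INF_lower) auto
    have B: "hausdorff_content s \<delta> B \<le> (\<Sum>i. ennreal (diameter (U i \<inter> B) powr s))"
      unfolding hausdorff_content_def
      using U sub le by (intro INF_lower) auto
    have *: "ennreal (diameter (U i \<inter> A) powr s) + ennreal (diameter (U i \<inter> B) powr s)
       \<le> ennreal (diameter (U i) powr s)" for i
    proof -
      have "U i \<inter> A = {} \<or> U i \<inter> B = {}"
      proof (rule ccontr)
        assume "\<not> ?thesis"
        then obtain x y where "x \<in> U i" "x \<in> A" "y \<in> U i" "y \<in> B" by blast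
        then have "e \<le> dist x y" "dist x y \<le> diameter (U i)"
          using sep U(3) by (auto intro: diameter_bounded_bound)
        then show False using U(3) \<delta> by (meson not_le order_trans)
      qed
      moreover have "ennreal (diameter (U i \<inter> X) powr s) \<le> ennreal (diameter (U i) powr s)" for X
        using sub[of i X] nn s by (intro ennreal_leI powr_mono2) auto
      ultimately show ?thesis by auto
    qed
    have "hausdorff_content s \<delta> A + hausdorff_content s \<delta> B \<le>
       (\<Sum>i. ennreal (diameter (U i \<inter> A) powr s) + ennreal (diameter (U i \<inter> B) powr s))"
      using add_mono[OF A B] by (simp add: suminf_add[OF summableI summableI])
    also have "\<dots> \<le> (\<Sum>i. ennreal (diameter (U i) powr s))"
      by (intro suminf_le summableI *)
    finally show "hausdorff_content s \<delta> A + hausdorff_content s \<delta> B \<le> (\<Sum>i. ennreal (diameter (U i) powr s))" .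
  qed
  have "hausdorff_outer s A + hausdorff_outer s B =
      (SUP \<delta>\<in>{0<..}. hausdorff_content s \<delta> A + hausdorff_outer s B)"
    unfolding hausdorff_outer_def[of s A] by (subst ennreal_SUP_add_left) auto
  also have "\<dots> \<le> hausdorff_outer s (A \<union> B)"
  proof (rule SUP_least)
    fix \<delta> :: real assume d: "\<delta> \<in> {0<..}"
    have "hausdorff_content s \<delta> A + hausdorff_outer s B =
       (SUP \<delta>'\<in>{0<..}. hausdorff_content s \<delta> A + hausdorff_content s \<delta>' B)"
      unfolding hausdorff_outer_def[of s B] by (subst ennreal_SUP_add_right) auto
    also have "\<dots> \<le> hausdorff_outer s (A \<union> B)"
    proof (rule SUP_least)
      fix \<delta>' :: real assume d': "\<delta>' \<in> {0<..}"
      define \<eta> where "\<eta> = min (min \<delta> \<delta>') (e/2)"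
      have eta: "\<eta> > 0" "\<eta> < e" "\<eta> \<le> \<delta>" "\<eta> \<le> \<delta>'"
        using d d' e by (auto simp: \<eta>_def)
      have "hausdorff_content s \<delta> A + hausdorff_content s \<delta>' B \<le>
          hausdorff_content s \<eta> A + hausdorff_content s \<eta> B"
        using eta by (intro add_mono hausdorff_content_antimono)
      also have "\<dots> \<le> hausdorff_content s \<eta> (A \<union> B)" using eta by (intro content)
      also have "\<dots> \<le> hausdorff_outer s (A \<union> B)" using eta by (intro hausdorff_content_le_outer)
      finally show "hausdorff_content s \<delta> A + hausdorff_content s \<delta>' B \<le> hausdorff_outer s (A \<union> B)" .
    qed
    finally show "hausdorff_content s \<delta> A + hausdorff_outer s B \<le> hausdorff_outer s (A \<union> B)" .
  qed
  finally show ?thesis .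
qed

lemma hausdorff_outer_closed_split:
  fixes F X :: "'a::metric_space set"
  assumes s: "s \<ge> 0" and F: "closed F"
  shows "hausdorff_outer s (X \<inter> F) + hausdorff_outer s (X - F) \<le> hausdorff_outer s X"
proof (cases "F = {} \<or> hausdorff_outer s X = top")
  case True
  then show ?thesis by (auto simp: hausdorff_outer_empty)
next
  case False
  let ?H = "hausdorff_outer s :: 'a set \<Rightarrow> ennreal"
  have F': "F \<noteq> {}" and fin: "?H X \<noteq> top" using False by auto
  define D where "D n = {x \<in> X. infdist x F > 1 / (real n + 1)}" for n
  define R where "R n = D (Suc n) - D n" for n
  have D_mono: "D m \<subseteq> D n" if "m \<le> n" for m n
  proof -
    have "1 / (real n + 1) \<le> 1 / (real m + 1)" using that by (intro divide_left_mono) auto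
    then show ?thesis by (auto simp: D_def)
  qed
  have D_sub: "D n \<subseteq> X" for n by (auto simp: D_def)
  have lip: "infdist x F \<le> infdist y F + dist x y" for x y by (rule infdist_triangle)
  have D_lim: "\<exists>n. x \<in> D n" if "x \<in> X - F" for x
  proof -
    have "infdist x F \<noteq> 0" using that F F' in_closed_iff_infdist_zero by blast
    then have "infdist x F > 0" using infdist_nonneg[of x F] by linarith
    then obtain n where "1 / (real (Suc n)) < infdist x F" by (rule nat_approx_posE)
    then show ?thesis using that by (auto simp: D_def intro!: exI[of _ n] simp: add.commute)
  qed
  have sepF: "?H (X \<inter> F) + ?H (D n) \<le> ?H X" for n
  proof -
    have "?H (X \<inter> F) + ?H (D n) \<le> ?H (X \<inter> F \<union> D n)"
    proof (rule hausdorff_outer_separated[OF s, of "1 / (real n + 1)"])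
      fix x y assume "x \<in> X \<inter> F" "y \<in> D n"
      then show "1 / (real n + 1) \<le> dist x y"
        using lip[of y x] by (auto simp: D_def dist_commute)
    qed auto
    also have "\<dots> \<le> ?H X" using D_sub by (intro hausdorff_outer_mono) auto
    finally show ?thesis .
  qed
  have par: "(\<Sum>i<N. ?H (R (2 * i + c))) \<le> ?H (\<Union>i<N. R (2 * i + c))" for N c
  proof (induction N)
    case 0 then show ?case by simp
  next
    case (Suc N)
    define e where "e = 1 / (real (2*N+c)) - 1 / (real (2*N+c) + 1)"
    show ?case
    proof (cases "N = 0")
      case True then show ?thesis by (simp add: lessThan_Suc)
    next
      case False
      have "e > 0" using False unfolding e_def by (intro diff_gt_0_iff_gt[THEN iffD2] divide_strict_left_mono) auto
      have "(\<Sum>i<Suc N. ?H (R (2 * i + c))) \<le> ?H (\<Union>i<N. R (2 * i + c)) + ?H (R (2*N+c))"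
        using Suc by (simp add: add_right_mono)
      also have "\<dots> \<le> ?H ((\<Union>i<N. R (2 * i + c)) \<union> R (2*N+c))"
      proof (rule hausdorff_outer_separated[OF s \<open>e > 0\<close>])
        fix x y assume x: "x \<in> (\<Union>i<N. R (2 * i + c))" and y: "y \<in> R (2*N+c)"
        from x obtain i where i: "i < N" "x \<in> D (Suc (2*i+c))" by (auto simp: R_def)
        have "D (Suc (2*i+c)) \<subseteq> D (2*N+c-1)" using i by (intro D_mono) auto
        then have "x \<in> D (2*N+c-1)" using i by auto
        moreover have "real (2*N+c-1) + 1 = real (2*N+c)" using False by simp
        ultimately have "infdist x F > 1 / real (2*N+c)" unfolding D_def by simp
        moreover have "infdist y F \<le> 1 / (real (2*N+c) + 1)"
          using y by (auto simp: R_def D_def)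
        ultimately show "e \<le> dist x y" using lip[of x y] by (auto simp: e_def)
      qed
      also have "(\<Union>i<N. R (2 * i + c)) \<union> R (2*N+c) = (\<Union>i<Suc N. R (2 * i + c))"
        by (auto simp: less_Suc_eq)
      finally show ?thesis .
    qed
  qed
  have par_le: "(\<Sum>i. ?H (R (2 * i + c))) \<le> ?H X" for c
  proof (rule suminf_le_const[OF summableI])
    fix N
    have "?H (\<Union>i<N. R (2 * i + c)) \<le> ?H X"
      using D_sub by (intro hausdorff_outer_mono) (auto simp: R_def)
    with par show "(\<Sum>i<N. ?H (R (2 * i + c))) \<le> ?H X" by (rule order_trans)
  qed
  have part: "(\<Sum>i<N. ?H (R i)) \<le> ?H X + ?H X" for N
  proof -
    have "(\<Sum>i<N. ?H (R i)) \<le> (\<Sum>i<2*N. ?H (R i))" by (intro sum_mono2) auto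
    also have "\<dots> = (\<Sum>i<N. ?H (R (2 * i + 0))) + (\<Sum>i<N. ?H (R (2 * i + 1)))"
      by (induction N) (simp_all add: ac_simps)
    also have "\<dots> \<le> (\<Sum>i. ?H (R (2 * i + 0))) + (\<Sum>i. ?H (R (2 * i + 1)))"
      by (intro add_mono sum_le_suminf summableI) auto
    also have "\<dots> \<le> ?H X + ?H X" by (intro add_mono par_le)
    finally show ?thesis .
  qed
  have "(\<Sum>i. ?H (R i)) \<le> ?H X + ?H X" by (intro suminf_le_const summableI part)
  then have sumfin: "(\<Sum>i. ?H (R i)) \<noteq> top" using fin by (auto simp: top_unique)
  have tail: "(\<lambda>n. \<Sum>i. ?H (R (i + n))) \<longlonglongrightarrow> 0"
  proof -
    have fin1: "?H (R i) \<noteq> top" for i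
      using sumfin sum_le_suminf[OF summableI, of "{i}" "\<lambda>i. ?H (R i)"] by (auto simp: top_unique)
    define r where "r i = enn2real (?H (R i))" for i
    have r: "?H (R i) = ennreal (r i)" "r i \<ge> 0" for i
      using fin1[of i] by (auto simp: r_def less_top)
    have sr: "summable r"
      using sumfin r by (intro summable_suminf_not_top) auto
    have "(\<Sum>i. ?H (R (i + n))) = ennreal (\<Sum>i. r (i + n))" for n
      unfolding r(1) using sr r(2)
      by (intro suminf_ennreal2) (auto simp: summable_iff_shift)
    moreover have "(\<lambda>n. \<Sum>i. r (i + n)) \<longlonglongrightarrow> 0" using suminf_exist_split2[OF sr] .
    ultimately show ?thesis using tendsto_ennrealI[of "\<lambda>n. \<Sum>i. r (i + n)" 0] by simp
  qed
  have bound: "?H (X \<inter> F) + ?H (X - F) \<le> ?H X + (\<Sum>i. ?H (R (i + n)))" for n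
  proof -
    have "X - F \<subseteq> D n \<union> (\<Union>i. R (i + n))"
    proof
      fix x assume "x \<in> X - F"
      then have ex: "\<exists>m. x \<in> D m" by (rule D_lim)
      define m where "m = (LEAST m. x \<in> D m)"
      have xm: "x \<in> D m" unfolding m_def using ex by (rule LeastI_ex)
      show "x \<in> D n \<union> (\<Union>i. R (i + n))"
      proof (cases "m \<le> n")
        case True then show ?thesis using D_mono xm by blast
      next
        case False
        then obtain i where i: "m = Suc (i + n)"
          by (metis add.commute add_Suc less_imp_Suc_add not_le)
        have "x \<notin> D (i + n)" using i not_less_Least[of "i + n" "\<lambda>m. x \<in> D m"] by (auto simp: m_def)
        then have "x \<in> R (i + n)" using xm i by (auto simp: R_def)
        then show ?thesis by blast
      qed
    qed
    then have "?H (X - F) \<le> ?H (D n \<union> (\<Union>i. R (i + n)))" by (rule hausdorff_outer_mono)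
    also have "\<dots> \<le> ?H (D n) + ?H (\<Union>i. R (i + n))" by (rule hausdorff_outer_Un)
    also have "\<dots> \<le> ?H (D n) + (\<Sum>i. ?H (R (i + n)))"
      by (intro add_left_mono hausdorff_outer_subadd)
    finally have "?H (X \<inter> F) + ?H (X - F) \<le> (?H (X \<inter> F) + ?H (D n)) + (\<Sum>i. ?H (R (i + n)))"
      by (simp add: add_left_mono add.assoc)
    also have "\<dots> \<le> ?H X + (\<Sum>i. ?H (R (i + n)))" by (intro add_right_mono sepF)
    finally show ?thesis .
  qed
  have "(\<lambda>n. ?H X + (\<Sum>i. ?H (R (i + n)))) \<longlonglongrightarrow> ?H X + 0"
    using tail fin by (intro tendsto_add tendsto_const)
  then show ?thesis
    by (intro LIMSEQ_le_const[where X = "\<lambda>n. ?H X + (\<Sum>i. ?H (R (i + n)))"]) (auto intro: bound)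
qed

lemma measure_space_hausdorff:
  assumes s: "s \<ge> 0"
  shows "measure_space UNIV (sets borel) (hausdorff_outer s :: 'a::metric_space set \<Rightarrow> ennreal)"
proof -
  let ?H = "hausdorff_outer s :: 'a set \<Rightarrow> ennreal"
  interpret P: sigma_algebra UNIV "UNIV :: 'a set set"
    using sigma_algebra_Pow[of "UNIV :: 'a set"] by simp
  let ?L = "lambda_system UNIV UNIV ?H"
  have ms: "measure_space UNIV ?L ?H"
    by (rule P.caratheodory_lemma[OF outer_measure_space_hausdorff])
  then interpret L: sigma_algebra UNIV ?L by (simp add: measure_space_def)
  have "{F. closed F} \<subseteq> ?L"
  proof clarsimp
    fix F :: "'a set" assume F: "closed F"
    have "?H (X \<inter> F) + ?H (X - F) = ?H X" for X
      using hausdorff_outer_closed_split[OF s F, of X] hausdorff_outer_Un[of s "X \<inter> F" "X - F"]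
      by (simp add: Int_Diff_Un)
    then show "F \<in> ?L" unfolding P.lambda_system_eq by auto
  qed
  then have sub: "sets borel \<subseteq> ?L"
    unfolding borel_eq_closed by (simp add: L.sigma_sets_subset)
  have "sigma_algebra UNIV (sets (borel :: 'a measure))"
    using sets.sigma_algebra_axioms[of "borel :: 'a measure"] by simp
  then show ?thesis
    using ms sub unfolding measure_space_def positive_def countably_additive_def by blast
qed

lemma sets_hausdorff_measure [simp, measurable_cong]: "sets (hausdorff_measure s) = sets borel"
  unfolding hausdorff_measure_def using sets.sigma_sets_eq[of borel] by (simp add: sets_measure_of)

lemma space_hausdorff_measure [simp]: "space (hausdorff_measure s) = UNIV"
  unfolding hausdorff_measure_def by (simp add: space_measure_of)

lemma emeasure_hausdorff_measure:
  assumes "s \<ge> 0" and A: "A \<in> sets borel"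
  shows "emeasure (hausdorff_measure s) A = hausdorff_outer s A"
  unfolding hausdorff_measure_def
  using measure_space_hausdorff[OF assms(1), where 'a='a] A
  by (intro emeasure_measure_of_sigma) (auto simp: measure_space_def)


section \<open>The Heisenberg group with the Koranyi distance\<close>

text \<open>
  \<open>\<real>\<^sup>2\<^sup>k\<close> is represented as \<open>\<real>\<^sup>k \<times> \<real>\<^sup>k\<close> with \<open>k = CARD('k)\<close>: the coordinates
  \<open>v\<^sub>1, \<dots>, v\<^sub>k\<close> form the first component and \<open>v\<^sub>k\<^sub>+\<^sub>1, \<dots>, v\<^sub>2\<^sub>k\<close> the second one. A separate type
  is needed because the metric differs from the Euclidean metric of the underlying vector space;
  \<open>coords\<close> is the identification with that vector space.
\<close>

typedef ('k::finite) heis = "UNIV :: (((real^'k) \<times> (real^'k)) \<times> real) set"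
  morphisms coords Heis ..

lemma coords_Heis [simp]: "coords (Heis x) = x"
  by (simp add: Heis_inverse)

lemma Heis_coords [simp]: "Heis (coords p) = p"
  by (simp add: coords_inverse)

definition omega :: "(real^'k) \<times> (real^'k) \<Rightarrow> (real^'k) \<times> (real^'k) \<Rightarrow> real" where
  "omega v w = (\<Sum>j\<in>UNIV. fst v $ j * snd w $ j - snd v $ j * fst w $ j)"

definition heis_mult :: "'k::finite heis \<Rightarrow> 'k heis \<Rightarrow> 'k heis" (infixl "\<odot>" 70) where
  "p \<odot> q = Heis (fst (coords p) + fst (coords q),
      snd (coords p) + snd (coords q) + omega (fst (coords p)) (fst (coords q)) / 2)"

definition heis_one :: "'k::finite heis" where
  "heis_one = Heis (0, 0)"

definition heis_inv :: "'k::finite heis \<Rightarrow> 'k heis" where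
  "heis_inv p = Heis (- fst (coords p), - snd (coords p))"

definition koranyi :: "'k::finite heis \<Rightarrow> real" where
  "koranyi p = root 4 (norm (fst (coords p)) ^ 4 + 16 * snd (coords p) ^ 2)"

lemma omega_inner: "omega v w = fst v \<bullet> snd w - snd v \<bullet> fst w"
  by (simp add: omega_def inner_vec_def sum_subtractf)

lemma heis_mult_assoc: "(p \<odot> q) \<odot> r = p \<odot> (q \<odot> r)"
  by (simp add: heis_mult_def omega_inner inner_add_left inner_add_right field_simps)

lemma heis_one_left: "heis_one \<odot> p = p"
  by (simp add: heis_mult_def heis_one_def omega_inner)

lemma heis_one_right: "p \<odot> heis_one = p"
  by (simp add: heis_mult_def heis_one_def omega_inner)

lemma heis_inv_left: "heis_inv p \<odot> p = heis_one"
  by (simp add: heis_mult_def heis_one_def heis_inv_def omega_inner inner_commute)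

lemma heis_inv_right: "p \<odot> heis_inv p = heis_one"
  by (simp add: heis_mult_def heis_one_def heis_inv_def omega_inner inner_commute)

lemma heis_inv_mult: "heis_inv (heis_inv q \<odot> p) = heis_inv p \<odot> q"
  by (simp add: heis_mult_def heis_inv_def omega_inner inner_commute diff_divide_distrib)

lemma koranyi_inv: "koranyi (heis_inv p) = koranyi p"
  by (simp add: koranyi_def heis_inv_def)

lemma koranyi_nonneg: "koranyi p \<ge> 0"
  by (simp add: koranyi_def)

lemma koranyi_eq_0: "koranyi p = 0 \<longleftrightarrow> p = heis_one"
proof -
  have "koranyi p = 0 \<longleftrightarrow> norm (fst (coords p)) ^ 4 + 16 * snd (coords p) ^ 2 = 0"
    by (simp add: koranyi_def)
  also have "\<dots> \<longleftrightarrow> coords p = (0, 0)"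
    by (subst add_nonneg_eq_0_iff) (auto simp: prod_eq_iff)
  also have "\<dots> \<longleftrightarrow> p = heis_one"
    unfolding heis_one_def by (metis coords_Heis Heis_coords)
  finally show ?thesis .
qed

lemma cmod_omega_le: "cmod (Complex (v \<bullet> w) (omega v w)) \<le> norm v * norm w"
proof -
  define a where "a = v \<bullet> w"
  define b where "b = omega v w"
  define c where "c = cmod (Complex a b)"
  define J where "J = (snd w, - fst w)"
  have c2: "c\<^sup>2 = a\<^sup>2 + b\<^sup>2" by (simp add: c_def cmod_power2)
  have "v \<bullet> J = b"
    by (simp add: b_def omega_inner J_def inner_prod_def)
  then have 1: "v \<bullet> (a *\<^sub>R w + b *\<^sub>R J) = c\<^sup>2"
    unfolding c2 by (simp add: inner_add_right power2_eq_square flip: a_def)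
  have wJ: "w \<bullet> J = 0" and JJ: "J \<bullet> J = w \<bullet> w"
    by (simp_all add: J_def inner_prod_def inner_commute)
  have "(norm (a *\<^sub>R w + b *\<^sub>R J))\<^sup>2 = a * a * (w \<bullet> w) + b * b * (w \<bullet> w)"
    unfolding power2_norm_eq_inner
    by (simp add: inner_add_left inner_add_right wJ JJ inner_commute[of J w])
  also have "\<dots> = (c * norm w)\<^sup>2"
    unfolding power_mult_distrib c2 power2_norm_eq_inner by (simp add: power2_eq_square distrib_right)
  finally have 2: "norm (a *\<^sub>R w + b *\<^sub>R J) = c * norm w"
    by (rule power2_eq_imp_eq) (auto simp: c_def)
  have "c * c \<le> c * (norm v * norm w)"
    using norm_cauchy_schwarz[of v "a *\<^sub>R w + b *\<^sub>R J"] unfolding 1 2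
    by (simp add: power2_eq_square mult.left_commute)
  then have "c \<le> norm v * norm w"
    by (cases "c = 0") (auto simp: c_def)
  then show ?thesis by (simp add: c_def a_def b_def)
qed

lemma koranyi_triangle: "koranyi (p \<odot> q) \<le> koranyi p + koranyi q"
proof -
  define z where "z p = Complex (norm (fst (coords p)) ^ 2) (4 * snd (coords p))" for p :: "'a heis"
  have z: "cmod (z p) = koranyi p ^ 2" for p
  proof (rule power2_eq_imp_eq)
    have "(koranyi p ^ 2)\<^sup>2 = koranyi p ^ 4" by simp
    also have "\<dots> = norm (fst (coords p)) ^ 4 + 16 * snd (coords p) ^ 2"
      unfolding koranyi_def by (rule real_root_pow_pos2) auto
    finally show "(cmod (z p))\<^sup>2 = (koranyi p ^ 2)\<^sup>2"
      by (simp add: z_def cmod_power2 power_mult_distrib)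
  qed auto
  have le: "norm (fst (coords p)) \<le> koranyi p" for p :: "'a heis"
  proof -
    have "(norm (fst (coords p)))\<^sup>2 \<le> cmod (z p)"
      using complex_Re_le_cmod[of "z p"] by (simp add: z_def)
    then show ?thesis unfolding z by (rule power2_le_imp_le) (rule koranyi_nonneg)
  qed
  let ?w = "Complex (fst (coords p) \<bullet> fst (coords q)) (omega (fst (coords p)) (fst (coords q)))"
  have "z (p \<odot> q) = z p + z q + 2 * ?w"
    by (simp add: z_def heis_mult_def complex_eq_iff power2_norm_eq_inner inner_add_left
        inner_add_right inner_commute)
  then have "cmod (z (p \<odot> q)) \<le> cmod (z p) + cmod (z q) + 2 * cmod ?w"
    using norm_triangle_ineq[of "z p + z q" "2 * ?w"] norm_triangle_ineq[of "z p" "z q"]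
    by (simp add: norm_mult)
  also have "cmod ?w \<le> norm (fst (coords p)) * norm (fst (coords q))" by (rule cmod_omega_le)
  also have "\<dots> \<le> koranyi p * koranyi q" by (intro mult_mono le koranyi_nonneg norm_ge_zero)
  finally have "koranyi (p \<odot> q) ^ 2 \<le> (koranyi p + koranyi q)\<^sup>2"
    unfolding z by (simp add: power2_sum)
  then show ?thesis by (rule power2_le_imp_le) (intro add_nonneg_nonneg koranyi_nonneg)
qed

instantiation heis :: (finite) metric_space
begin

definition dist_heis :: "'a heis \<Rightarrow> 'a heis \<Rightarrow> real" where
  "dist_heis p q = koranyi (heis_inv q \<odot> p)"

definition uniformity_heis :: "('a heis \<times> 'a heis) filter" where
  "uniformity_heis = (INF e\<in>{0<..}. principal {(x, y). dist x y < e})"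

definition open_heis :: "'a heis set \<Rightarrow> bool" where
  "open_heis U \<longleftrightarrow> (\<forall>x\<in>U. \<forall>\<^sub>F (x', y) in uniformity. x' = x \<longrightarrow> y \<in> U)"

instance
proof
  fix p q r :: "'a heis"
  have "q \<odot> (heis_inv q \<odot> p) = p"
    by (simp add: heis_mult_assoc[symmetric] heis_inv_right heis_one_left)
  then have "heis_inv q \<odot> p = heis_one \<longleftrightarrow> p = q"
    using heis_inv_left[of q] heis_one_right[of q] by auto
  then show "dist p q = 0 \<longleftrightarrow> p = q"
    by (simp add: dist_heis_def koranyi_eq_0)
  have comm: "dist q r = dist r q"
    unfolding dist_heis_def
    using koranyi_inv[of "heis_inv r \<odot> q"] by (simp add: heis_inv_mult)
  have "r \<odot> (heis_inv r \<odot> p) = p"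
    by (simp add: heis_mult_assoc[symmetric] heis_inv_right heis_one_left)
  then have "heis_inv q \<odot> p = (heis_inv q \<odot> r) \<odot> (heis_inv r \<odot> p)"
    by (simp add: heis_mult_assoc)
  then have "dist p q \<le> dist r q + dist p r"
    unfolding dist_heis_def using koranyi_triangle[of "heis_inv q \<odot> r" "heis_inv r \<odot> p"] by simp
  then show "dist p q \<le> dist p r + dist q r" using comm by simp
qed (simp_all add: uniformity_heis_def open_heis_def)

end


section \<open>Ahlfors regularity, Carleson sets and bilateral beta-numbers\<close>

definition hdim :: "'k::finite itself \<Rightarrow> nat" where
  "hdim _ = 2 * CARD('k) + 1"

definition ahlfors_regular :: "real \<Rightarrow> 'k::finite heis set \<Rightarrow> bool" where
  "ahlfors_regular C E \<longleftrightarrow> closed E \<and>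
     (\<forall>p\<in>E. \<forall>r>0.
        ennreal (inverse C * r ^ hdim TYPE('k)) \<le> emeasure (hausdorff_measure (hdim TYPE('k))) (E \<inter> ball p r) \<and>
        emeasure (hausdorff_measure (hdim TYPE('k))) (E \<inter> ball p r) \<le> ennreal (C * r ^ hdim TYPE('k)))"

text \<open>Measurability is understood as Borel measurability in the product space.\<close>

definition carleson_set :: "'k::finite heis set \<Rightarrow> real \<Rightarrow> ('k heis \<times> real) set \<Rightarrow> bool" where
  "carleson_set E \<gamma>\<^sub>0 A \<longleftrightarrow> A \<subseteq> E \<times> {0<..} \<and> A \<in> sets borel \<and>
     (\<forall>p\<in>E. \<forall>r>0.
        (\<integral>\<^sup>+s\<in>{0<..<r}.
           ((\<integral>\<^sup>+q\<in>E \<inter> ball p r. indicator A (q, s) \<partial>hausdorff_measure (hdim TYPE('k)))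
             * ennreal (1 / s)) \<partial>lborel)
        \<le> ennreal (\<gamma>\<^sub>0 * r ^ hdim TYPE('k)))"

definition hyperplanes :: "'k::finite heis set set" where
  "hyperplanes = {P. \<exists>a b. a \<noteq> 0 \<and> P = {q. a \<bullet> coords q = b}}"

text \<open>
  The value is taken in \<^typ>\<open>ennreal\<close>, whose least element is \<open>0\<close>, so that suprema over the empty
  set are \<open>0\<close> as required. \<^const>\<open>infdist\<close> is only used for nonempty sets: hyperplanes are
  nonempty, and \<open>bbeta E p s\<close> is only used for \<open>p \<in> E\<close>.
\<close>

definition bbeta :: "'k::finite heis set \<Rightarrow> 'k heis \<Rightarrow> real \<Rightarrow> ennreal" where
  "bbeta E p s = ennreal (inverse s) *
     (INF P\<in>hyperplanes.
        (SUP q\<in>ball p s \<inter> E. ennreal (infdist q P)) + (SUP q\<in>ball p s \<inter> P. ennreal (infdist q E)))"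

definition BWGL :: "real \<Rightarrow> (real \<Rightarrow> real) \<Rightarrow> 'k::finite heis set set" where
  "BWGL C \<gamma> = {E. ahlfors_regular C E \<and>
     (\<forall>\<epsilon>\<in>{0<..<1}. carleson_set E (\<gamma> \<epsilon>) {(p, s). p \<in> E \<and> s > 0 \<and> bbeta E p s > ennreal \<epsilon>})}"

end

theory Submission
  imports Defs
begin

text \<open>
  On a point of \<open>E \<inter> E'\<close> a scale that is bad for \<open>E\<close> is bad for \<open>E'\<close>, or one of the two
  sets has a gap there: a point nearby that is far from the other set. Gaps satisfy a Carleson
  estimate by Fubini, since a gap at scale \<open>s\<close> forces a set of measure about \<open>s\<^sup>2\<^sup>k\<^sup>+\<^sup>1\<close> of
  points at distance about \<open>s\<close> from the other set. Hence, by Chebyshev's inequality, in every ball a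
  fixed proportion of the points of \<open>E\<close> have a bounded amount of bad scales, measured by \<open>ds/s\<close>.

  To pass from this to the Carleson condition in the manner of John and Nirenberg, let \<open>K\<close> be the
  best constant in the estimate over tents, where the tent over an open set \<open>U\<close> consists of all
  \<open>(x, s)\<close> with \<open>ball x s \<subseteq> U\<close>. A Vitali covering gives a compact set \<open>F \<subseteq> U\<close> of good points
  that carries a fixed proportion \<open>\<eta>\<close> of the measure of \<open>U\<close>. The tent over \<open>U - F\<close> contributes
  at most \<open>(1 - \<eta>) K\<close> times the measure of \<open>U\<close>, and the remaining scales see \<open>F\<close>, so
  \<open>K \<le> (1 - \<eta>) K + m\<close>.
\<close>

section \<open>Topology of the Heisenberg group\<close>

text \<open>The absorption applies the tent bound to U - F, so this set must be open; hence tents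
  over arbitrary open sets instead of balls, and hence the need for a closed set of good points.
  Fatou's lemma gives closedness once the bad scales are described by an open set \<open>W\<close>.
  That is the purpose of the lower semicontinuity of the beta-numbers, which also yields
  measurability. Bad scales of points outside F have to be seen from F. If (q, s) is bad at
  threshold \<epsilon>, every point of E within s of q is bad at scale 2 s for threshold \<epsilon>
  / 2; doubling the scale is free because ds/s is dilation invariant. So two thresholds coexist:
  \<open>W\<close> belongs to \<epsilon> / 2, the set to be estimated to \<epsilon>. Comparing E
  with E' loses another factor 10, so the hypothesis on E' is used at \<epsilon> / 20. The
  inequality for K says nothing if K is infinite; therefore scales are first cut off to a compact
  interval. The resulting bound depends neither on the cutoff nor on E.\<close>

lemma norm_fst_coords_le: "norm (fst (coords p) - fst (coords q)) \<le> dist p q"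
  and abs_snd_coords_le:
    "4 * \<bar>snd (coords p) - snd (coords q) - omega (fst (coords q)) (fst (coords p)) / 2\<bar>
        \<le> (dist p q)\<^sup>2"
proof -
  define v where "v = fst (coords p) - fst (coords q)"
  define t where "t = snd (coords p) - snd (coords q) - omega (fst (coords q)) (fst (coords p)) / 2"
  have d4: "dist p q ^ 4 = norm v ^ 4 + 16 * t\<^sup>2"
    unfolding dist_heis_def koranyi_def heis_mult_def heis_inv_def v_def t_def
    by (subst real_root_pow_pos2) (auto simp: omega_inner algebra_simps diff_divide_distrib)
  have "norm v ^ 4 \<le> dist p q ^ 4" unfolding d4 by simp
  then show "norm (fst (coords p) - fst (coords q)) \<le> dist p q"
    unfolding v_def by (rule power_le_imp_le_base[where n = 3, simplified]) simp
  have "(4 * \<bar>t\<bar>)\<^sup>2 \<le> ((dist p q)\<^sup>2)\<^sup>2" using d4 by (simp add: power_mult_distrib)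
  then have "4 * \<bar>t\<bar> \<le> (dist p q)\<^sup>2" by (rule power2_le_imp_le) simp
  then show "4 * \<bar>snd (coords p) - snd (coords q) - omega (fst (coords q)) (fst (coords p)) / 2\<bar>
      \<le> (dist p q)\<^sup>2"
    by (simp add: t_def)
qed

text \<open>The distance controls the vertical coordinate only up to the twist \<open>omega\<close>,
  and the twist vanishes in the limit because \<open>omega v v = 0\<close>. With
  \<open>tendsto_Heis\<close> this makes \<open>coords\<close> a homeomorphism, through which
  topological facts are imported from Euclidean space.\<close>

lemma tendsto_coords:
  assumes "(f \<longlongrightarrow> l) F"
  shows "((\<lambda>x. coords (f x)) \<longlongrightarrow> coords l) F"
proof -
  have d: "((\<lambda>x. dist (f x) l) \<longlongrightarrow> 0) F"
    using assms by (rule tendsto_dist_iff[THEN iffD1])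
  have "((\<lambda>x. fst (coords (f x)) - fst (coords l)) \<longlongrightarrow> 0) F"
    by (rule Lim_null_comparison[OF _ d], rule always_eventually, rule allI, rule
        norm_fst_coords_le)
  then have v: "((\<lambda>x. fst (coords (f x))) \<longlongrightarrow> fst (coords l)) F" by (simp add: LIM_zero_cancel)
  have d2: "((\<lambda>x. (dist (f x) l)\<^sup>2) \<longlongrightarrow> 0) F" using tendsto_power[OF d, of 2] by simp
  have "((\<lambda>x. snd (coords (f x)) - snd (coords l) - omega (fst (coords l)) (fst (coords (f x))) /
      2) \<longlongrightarrow> 0) F"
  proof (rule Lim_null_comparison[OF _ d2], rule always_eventually, rule allI)
    fix x show "norm (snd (coords (f x)) - snd (coords l) - omega (fst (coords l)) (fst (coords (f
        x))) / 2) \<le> (dist (f x) l)\<^sup>2"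
      by (rule order_trans[OF _ abs_snd_coords_le]) simp
  qed
  moreover have "((\<lambda>x. omega (fst (coords l)) (fst (coords (f x))) / 2) \<longlongrightarrow> 0) F"
  proof -
    have "((\<lambda>x. omega (fst (coords l)) (fst (coords (f x))) / 2) \<longlongrightarrow> omega (fst (coords l)) (fst
        (coords l)) / 2) F"
      unfolding omega_inner by (intro tendsto_intros v) auto
    then show ?thesis by (simp add: omega_inner inner_commute)
  qed
  ultimately have "((\<lambda>x. (snd (coords (f x)) - snd (coords l) - omega (fst (coords l)) (fst
      (coords (f x))) / 2)
      + omega (fst (coords l)) (fst (coords (f x))) / 2) \<longlongrightarrow> 0 + 0) F"
    by (rule tendsto_add)
  then have "((\<lambda>x. snd (coords (f x)) - snd (coords l)) \<longlongrightarrow> 0) F" by simp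
  then have "((\<lambda>x. snd (coords (f x))) \<longlongrightarrow> snd (coords l)) F" by (simp add: LIM_zero_cancel)
  from tendsto_Pair[OF v this] show ?thesis by simp
qed

lemma tendsto_Heis:
  assumes "(f \<longlongrightarrow> l) F"
  shows "((\<lambda>x. Heis (f x)) \<longlongrightarrow> Heis l) F"
proof -
  have "((\<lambda>x. koranyi (heis_inv (Heis l) \<odot> Heis (f x))) \<longlongrightarrow> koranyi (heis_inv (Heis l) \<odot> Heis l)) F"
    unfolding koranyi_def heis_mult_def heis_inv_def omega_inner coords_Heis fst_conv snd_conv
    by (intro tendsto_intros assms) auto
  moreover have "koranyi (heis_inv (Heis l) \<odot> Heis l) = 0"
      by (simp only: heis_inv_left koranyi_eq_0)
  ultimately show ?thesis
    unfolding tendsto_dist_iff[of "\<lambda>x. Heis (f x)"] dist_heis_def by simp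
qed

lemma continuous_on_coords: "continuous_on S coords"
  unfolding continuous_on_def by (auto intro: tendsto_coords)

lemma continuous_on_Heis: "continuous_on S Heis"
  unfolding continuous_on_def by (auto intro: tendsto_Heis)

lemma open_heis_iff: "open U \<longleftrightarrow> open (coords ` U)"
proof -
  have 1: "coords ` U = Heis -` U" for U :: "'a heis set" by force
  have 2: "coords -` (coords ` U) = U" by (auto simp: coords_inject)
  show ?thesis
  proof
    assume "open U" then show "open (coords ` U)" unfolding 1
        by (rule open_vimage[OF _ continuous_on_Heis])
  next
    assume "open (coords ` U)"
    then have "open (coords -` (coords ` U))" by (rule open_vimage[OF _ continuous_on_coords])
    then show "open U" unfolding 2 .
  qed
qed

lemma bounded_coords:
  assumes "bounded S"
  shows "bounded (coords ` S)"
proof -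
  obtain R where R: "\<And>p. p \<in> S \<Longrightarrow> dist p heis_one \<le> R"
    using assms unfolding bounded_any_center[where a = heis_one] by (auto simp: dist_commute)
  have "norm (coords p) \<le> R + R\<^sup>2" if "p \<in> S" for p
  proof -
    have "norm (fst (coords p)) \<le> R"
      using norm_fst_coords_le[of p heis_one] R[OF that] by (simp add: heis_one_def)
    moreover have "norm (snd (coords p)) \<le> R\<^sup>2"
      using abs_snd_coords_le[of p heis_one] power_mono[OF R[OF that], of 2]
      by (simp add: heis_one_def omega_inner)
    ultimately show ?thesis using norm_Pair_le[of "fst (coords p)" "snd (coords p)"] by simp
  qed
  then show ?thesis unfolding bounded_iff by blast
qed

text \<open>Second countability makes the Borel sets of a product with the reals the product
  sigma-algebra, on which every use of Fubini relies.\<close>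

instance heis :: (finite) second_countable_topology
proof
  obtain B :: "(((real^'a) \<times> (real^'a)) \<times> real) set set"
    where B: "countable B" "topological_basis B" using ex_countable_basis by blast
  define B' where "B' = (\<lambda>b. Heis ` b) ` B"
  have im: "coords ` (Heis ` X) = X" for X :: "(((real^'a) \<times> (real^'a)) \<times> real) set"
    by (simp add: image_image)
  have mi: "Heis ` (coords ` X) = X" for X :: "'a heis set"
    by (simp add: image_image)
  have "topological_basis B'"
    unfolding topological_basis_def
  proof (intro conjI ballI allI impI)
    fix b assume "b \<in> B'"
    then show "open b" using B(2) by (auto simp: B'_def open_heis_iff im topological_basis_open)
  next
    fix U :: "'a heis set" assume "open U"
    then have "open (coords ` U)" by (simp add: open_heis_iff)
    then obtain X where X: "X \<subseteq> B" "\<Union> X = coords ` U" using B(2) unfolding topological_basis_def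
        by blast
    have "\<Union> ((\<lambda>b. Heis ` b) ` X) = Heis ` (\<Union> X)" by blast
    then show "\<exists>X\<subseteq>B'. \<Union> X = U" using X(1) unfolding X(2) mi B'_def
        by (intro exI[of _ "(\<lambda>b. Heis ` b) ` X"]) auto
  qed
  then show "\<exists>B::'a heis set set. countable B \<and> open = generate_topology B"
    using B(1) topological_basis_imp_subbasis[of B'] by (auto simp: B'_def)
qed

text \<open>Provides the compact sets of good points and the nearest points in closed sets.\<close>

instance heis :: (finite) heine_borel
proof
  fix f :: "nat \<Rightarrow> 'a heis" assume "bounded (range f)"
  then have "bounded (range (\<lambda>n. coords (f n)))" using bounded_coords by (metis image_image)
  then obtain l r where lr: "strict_mono (r :: nat \<Rightarrow> nat)" "((\<lambda>n. coords (f n)) \<circ> r) \<longlonglongrightarrow> l"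
    using bounded_imp_convergent_subsequence by blast
  then have "(\<lambda>n. Heis (((\<lambda>n. coords (f n)) \<circ> r) n)) \<longlonglongrightarrow> Heis l" by (intro tendsto_Heis)
  then have "(f \<circ> r) \<longlonglongrightarrow> Heis l" by (simp add: o_def)
  with lr(1) show "\<exists>l r. strict_mono (r :: nat \<Rightarrow> nat) \<and> (f \<circ> r) \<longlonglongrightarrow> l" by blast
qed

section \<open>The scale-invariant measure on scales\<close>

text \<open>The Haar measure of the multiplicative group of positive reals, extended by 0 to the
  whole line: nonpositive scales are negligible, so sets of scales need no restriction to
  \<open>{0<..}\<close>.\<close>

definition log_measure :: "real measure" where
  "log_measure = density lborel (\<lambda>s. ennreal (indicator {0<..} s / s))"

lemma sets_log_measure [simp, measurable_cong]: "sets log_measure = sets borel"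
  by (simp add: log_measure_def)

lemma space_log_measure [simp]: "space log_measure = UNIV"
  by (simp add: log_measure_def)

lemma nn_integral_log_measure:
  assumes [measurable]: "f \<in> borel_measurable borel"
  shows "(\<integral>\<^sup>+s. f s \<partial>log_measure) = (\<integral>\<^sup>+s\<in>{0<..}. f s * ennreal (1 / s) \<partial>lborel)"
  unfolding log_measure_def
  by (subst nn_integral_density) (auto intro!: nn_integral_cong simp: indicator_def mult.commute)

lemma emeasure_log_measure:
  assumes [measurable]: "A \<in> sets borel"
  shows "emeasure log_measure A = (\<integral>\<^sup>+s\<in>{0<..}. indicator A s * ennreal (1 / s) \<partial>lborel)"
  using nn_integral_log_measure[of "indicator A"] by simp

lemma sigma_finite_log_measure: "sigma_finite_measure log_measure"
  unfolding log_measure_def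
  by (subst sigma_finite_measure.sigma_finite_iff_density_finite[OF
      lborel.sigma_finite_measure_axioms]) auto

interpretation log_measure: sigma_finite_measure log_measure
  by (rule sigma_finite_log_measure)

lemma AE_log_measure_pos: "AE s in log_measure. 0 < s"
  unfolding log_measure_def by (subst AE_density) (auto simp: indicator_def)

lemma emeasure_log_measure_Icc:
  assumes "0 < a" "a \<le> b"
  shows "emeasure log_measure {a..b} = ennreal (ln (b / a))"
proof -
  have "((\<lambda>s. 1 / s) has_integral (ln b - ln a)) {a..b}"
    using assms by (intro fundamental_theorem_of_calculus)
      (auto intro!: derivative_eq_intros simp flip: has_real_derivative_iff_has_vector_derivative)
  then have "integral\<^sup>N lborel (\<lambda>s. indicator {a..b} s * (1 / s)) = ennreal (ln b - ln a)"
    using assms by (intro nn_integral_has_integral_lebesgue) auto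
  moreover have "emeasure log_measure {a..b} = integral\<^sup>N lborel (\<lambda>s. indicator {a..b} s * (1 / s))"
    using assms by (subst emeasure_log_measure) (auto intro!: nn_integral_cong simp: indicator_def)
  ultimately show ?thesis using assms by (simp add: ln_div)
qed

text \<open>This invariance makes every later passage between the scales s and 2 s free of
  cost.\<close>

lemma emeasure_log_measure_scale:
  assumes c: "0 < c" and A [measurable]: "A \<in> sets borel"
  shows "emeasure log_measure ((*) c -` A) = emeasure log_measure A"
proof -
  have [measurable]: "(*) c -` A \<in> sets borel"
    by (rule measurable_sets_borel[of _ borel]) auto
  have "emeasure log_measure A = ennreal c * (\<integral>\<^sup>+s. indicator A (c * s) * ennreal (1 / (c * s)) *
      indicator {0<..} (c * s) \<partial>lborel)"
    unfolding emeasure_log_measure[OF A]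
    by (subst nn_integral_real_affine[where c = c and t = 0]) (use c in auto)
  also have "\<dots> = (\<integral>\<^sup>+s. ennreal c * (indicator A (c * s) * ennreal (1 / (c * s)) * indicator
      {0<..} (c * s)) \<partial>lborel)"
    by (subst nn_integral_cmult) auto
  also have "\<dots> = emeasure log_measure ((*) c -` A)"
    unfolding emeasure_log_measure[OF \<open>(*) c -` A \<in> sets borel\<close>]
    using c by (intro nn_integral_cong) (auto simp: indicator_def zero_less_mult_iff simp flip:
        ennreal_mult')
  finally show ?thesis ..
qed

definition scale_measure :: "('a \<times> real) set \<Rightarrow> 'a \<Rightarrow> ennreal" where
  "scale_measure A x = emeasure log_measure (Pair x -` A)"

definition scales_below :: "real \<Rightarrow> ('a \<times> real) set" where
  "scales_below r = UNIV \<times> {..<r}"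

lemma mem_scales_below [simp]: "(x, s) \<in> scales_below r \<longleftrightarrow> s < r"
  by (simp add: scales_below_def)

lemma scales_below_borel [measurable]: "(scales_below r :: ('a::topological_space \<times> real) set) \<in>
    sets borel"
  unfolding scales_below_def by (intro borel_open open_Times) auto

lemma Pair_vimage_borel [measurable]:
  fixes A :: "('a::{second_countable_topology} \<times> real) set"
  assumes "A \<in> sets borel" shows "Pair x -` A \<in> sets borel"
proof -
  have "A \<in> sets (borel \<Otimes>\<^sub>M borel)" unfolding borel_prod by (rule assms)
  then show ?thesis by (rule sets_Pair1)
qed

lemma scale_measure_mono:
  fixes B :: "('a::{second_countable_topology} \<times> real) set"
  assumes "B \<in> sets borel" "\<And>s. 0 < s \<Longrightarrow> (x, s) \<in> A \<Longrightarrow> (x, s) \<in> B"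
  shows "scale_measure A x \<le> scale_measure B x"
proof (cases "Pair x -` A \<in> sets borel")
  case True
  from AE_log_measure_pos have "AE s in log_measure. s \<in> Pair x -` A \<longrightarrow> s \<in> Pair x -` B"
    using assms(2) by (auto elim!: eventually_mono)
  then show ?thesis
    unfolding scale_measure_def by (rule emeasure_mono_AE) (use assms(1) in auto)
next
  \<comment> \<open>A section outside the sigma-algebra has \<open>emeasure\<close> 0 by
    convention.\<close>
  case False
  then show ?thesis by (simp add: scale_measure_def emeasure_notin_sets)
qed

lemma scale_measure_nn_integral:
  fixes A :: "('a::{second_countable_topology} \<times> real) set"
  assumes "A \<in> sets borel"
  shows "scale_measure A x = (\<integral>\<^sup>+s. indicator A (x, s) \<partial>log_measure)"
proof -
  have "(\<lambda>s. indicator A (x, s) :: ennreal) = indicator (Pair x -` A)"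
      by (auto simp: indicator_def fun_eq_iff)
  then show ?thesis using Pair_vimage_borel[OF assms, of x] by (simp add: scale_measure_def)
qed

section \<open>Ahlfors regular measures\<close>

text \<open>The measure lives on the whole space and is concentrated on \<open>E\<close>. The locale
  is used for \<open>E\<close> and for a piece \<open>E'\<close> alike, with different regularity
  constants.\<close>

locale ahlfors_measure =
  fixes M :: "'a::{heine_borel, second_countable_topology} measure"
    and E :: "'a set" and C :: real and Q :: nat
  assumes sets_M [measurable_cong]: "sets M = sets borel"
    and closed_E: "closed E"
    and AE_E: "AE x in M. x \<in> E"
    and C_ge_1: "1 \<le> C"
    and ball_lower: "\<And>p r. p \<in> E \<Longrightarrow> 0 < r \<Longrightarrow> ennreal (r ^ Q / C) \<le> emeasure M (ball p r)"
    and ball_upper: "\<And>p r. p \<in> E \<Longrightarrow> 0 < r \<Longrightarrow> emeasure M (ball p r) \<le> ennreal (C * r ^ Q)"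
begin

lemma space_M [simp]: "space M = UNIV"
  using sets_eq_imp_space_eq[OF sets_M] by simp

lemma E_borel [measurable]: "E \<in> sets borel"
  using closed_E by (rule borel_closed)

lemma emeasure_bounded_finite:
  assumes "bounded S" "S \<in> sets borel"
  shows "emeasure M S < \<infinity>"
proof (cases "E = {}")
  case True
  then have "AE x in M. x \<notin> S" using AE_E by (auto elim: eventually_mono)
  then have "emeasure M S = 0"
    using AE_iff_measurable[of S M "\<lambda>x. x \<notin> S"] assms(2) by (simp add: sets_M)
  then show ?thesis by simp
next
  case False
  then obtain p where p: "p \<in> E" by blast
  obtain r where "0 < r" "S \<subseteq> ball p r" using assms(1) bounded_subset_ballD by blast
  then have "emeasure M S \<le> ennreal (C * r ^ Q)"
    using p by (intro order_trans[OF emeasure_mono ball_upper]) (auto simp: sets_M)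
  then show ?thesis using le_less_trans by fastforce
qed

sublocale sigma_finite_measure M
proof
  fix p :: 'a
  define A where "A = range (\<lambda>n::nat. ball p (real n))"
  have "\<exists>n::nat. dist p x < real n" for x by (rule reals_Archimedean2)
  then show "\<exists>A. countable A \<and> A \<subseteq> sets M \<and> \<Union> A = space M \<and> (\<forall>a\<in>A. emeasure M a \<noteq> \<infinity>)"
    using emeasure_bounded_finite by (intro exI[of _ A]) (auto simp: A_def sets_M
        less_top[symmetric])
qed

sublocale scale_pair: pair_sigma_finite M log_measure ..

lemma scale_measure_measurable [measurable]:
  assumes "A \<in> sets borel"
  shows "scale_measure A \<in> borel_measurable M"
proof -
  have "A \<in> sets (M \<Otimes>\<^sub>M log_measure)"
    unfolding sets_pair_measure_cong[OF sets_M sets_log_measure] borel_prod by (rule assms)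
  then show ?thesis unfolding scale_measure_def by (rule scale_pair.measurable_emeasure_Pair1)
qed

end

text \<open>The radius \<open>2 * s\<close> is what \<open>bbeta_comparison\<close> needs. Both
  inequalities are strict, so that the set is a union of open sets and thus Borel without any
  assumption on \<open>E\<close> or \<open>Z\<close>.\<close>

definition gap_set :: "real \<Rightarrow> 'a::metric_space set \<Rightarrow> 'a set \<Rightarrow> ('a \<times> real) set" where
  "gap_set e E Z = {(x, s). \<exists>y\<in>E. dist x y < 2 * s \<and> e * s < infdist y Z}"

lemma open_gap_set: "open (gap_set e E Z)"
proof -
  have "gap_set e E Z = (\<Union>y\<in>E. {z. dist (fst z) y < 2 * snd z} \<inter> {z. e * snd z < infdist y Z})"
    by (auto simp: gap_set_def)
  also have "open \<dots>"
    by (intro open_UN ballI open_Int open_Collect_less continuous_intros)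
  finally show ?thesis .
qed

lemma gap_set_borel [measurable]: "gap_set e E Z \<in> sets borel"
  by (rule borel_open[OF open_gap_set])

text \<open>The three factors \<open>C\<close> come from a lower bound for a ball of radius e s / 2
  and upper bounds for balls of radii 3 s and 4 r; 24 / e is (2 / e) times 3 times 4. The logarithm
  is the mass of the scales between d / 3 and 2 d / e.\<close>

definition gap_const :: "real \<Rightarrow> nat \<Rightarrow> real \<Rightarrow> real" where
  "gap_const C Q e = C ^ 3 * (24 / e) ^ Q * ln (6 / e)"

lemma gap_const_nonneg: "0 \<le> C \<Longrightarrow> 0 < e \<Longrightarrow> e \<le> 1 \<Longrightarrow> 0 \<le> gap_const C Q e"
  by (auto simp: gap_const_def intro!: mult_nonneg_nonneg ln_ge_zero)

context ahlfors_measure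
begin

text \<open>
  A bad scale at \<open>x\<close> is charged to the points \<open>z\<close> near \<open>x\<close> whose distance to \<open>Z\<close> is comparable to
  the scale; a given \<open>z\<close> is charged only by scales in an interval of bounded ratio.
\<close>

lemma gap_set_witness:
  assumes e: "0 < e" "e \<le> 1" and "x \<in> Z" "0 < s" "(x, s) \<in> gap_set e E Z"
  shows "1 \<le> ennreal (C * (2 / (e * s)) ^ Q) *
    emeasure M {z. dist x z < 3 * s \<and> e * s / 2 \<le> infdist z Z \<and> infdist z Z \<le> 3 * s}"
proof -
  obtain y where y: "y \<in> E" "dist x y < 2 * s" "e * s < infdist y Z"
    using assms(5) by (auto simp: gap_set_def)
  have es: "0 < e * s" "e * s \<le> s" using assms by auto
  \<comment> \<open>The distance to \<open>Z\<close> is 1-Lipschitz, so it loses at most half of its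
    value e s at y; it is at most \<open>dist z x\<close> because \<open>x\<close> lies in
    \<open>Z\<close>.\<close>
  have sub: "ball y (e * s / 2) \<subseteq> {z. dist x z < 3 * s \<and> e * s / 2 \<le> infdist z Z \<and> infdist z Z
      \<le> 3 * s}"
  proof clarsimp
    fix z assume z: "dist y z * 2 < e * s"
    have "dist x z < 3 * s" using dist_triangle[of x z y] y z es by linarith
    moreover have "infdist z Z \<le> dist z x" using \<open>x \<in> Z\<close> by (rule infdist_le)
    moreover have "infdist y Z \<le> infdist z Z + dist y z" by (rule infdist_triangle)
    ultimately show "dist x z < 3 * s \<and> e * s \<le> infdist z Z * 2 \<and> infdist z Z \<le> 3 * s"
      using y z by (auto simp: dist_commute)
  qed
  have annulus: "{z. dist x z < 3 * s \<and> e * s / 2 \<le> infdist z Z \<and> infdist z Z \<le> 3 * s} \<in> sets borel"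
    unfolding Collect_conj_eq
    by (intro sets.Int borel_open[OF open_Collect_less] borel_closed[OF closed_Collect_le]
        continuous_intros) auto
  have "ennreal 1 = ennreal (C * (2 / (e * s)) ^ Q * ((e * s / 2) ^ Q / C))"
    using C_ge_1 es e by (simp add: power_divide)
  also have "\<dots> = ennreal (C * (2 / (e * s)) ^ Q) * ennreal ((e * s / 2) ^ Q / C)"
    using C_ge_1 es by (intro ennreal_mult) auto
  also have "\<dots> \<le> ennreal (C * (2 / (e * s)) ^ Q) *
     emeasure M {z. dist x z < 3 * s \<and> e * s / 2 \<le> infdist z Z \<and> infdist z Z \<le> 3 * s}"
    using es y annulus
    by (intro mult_left_mono order_trans[OF ball_lower emeasure_mono[OF sub]]) (simp_all add:
        sets_M)
  finally show ?thesis by simp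
qed

text \<open>The kernel \<open>f x s\<close>, integrated over z, gives every gap scale weight at
  least 1. In the reverse order of integration, each z in E receives a bounded total, and only the z
  within 4 r of p receive anything.\<close>

lemma gap_estimate:
  assumes e: "0 < e" "e \<le> 1" and p: "p \<in> E" and r: "0 < r" and Z [measurable]: "Z \<in> sets borel"
  shows "(\<integral>\<^sup>+x\<in>Z \<inter> ball p r. scale_measure (gap_set e E Z \<inter> scales_below r) x \<partial>M)
      \<le> ennreal (gap_const C Q e * r ^ Q)"
proof -
  define R where "R x s z \<longleftrightarrow> x \<in> Z \<and> dist p x < r \<and> 0 < s \<and> s < r \<and>
     dist x z < 3 * s \<and> e * s / 2 \<le> infdist z Z \<and> infdist z Z \<le> 3 * s" for x s z
  define c where "c s = C * (2 / (e * s)) ^ Q" for s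
  define f where "f x s z = ennreal (c s) * indicator {z. R x s z} z" for x s z
  have [measurable]: "(\<lambda>z. infdist z Z) \<in> borel_measurable borel"
    by (intro borel_measurable_continuous_onI continuous_intros)
  have [measurable]: "c \<in> borel_measurable borel" unfolding c_def by measurable
  have R [measurable]: "Measurable.pred (borel \<Otimes>\<^sub>M (borel \<Otimes>\<^sub>M borel)) (\<lambda>(x, s, z). R x s z)"
    unfolding R_def by measurable
  have [measurable]: "Measurable.pred (borel \<Otimes>\<^sub>M (borel \<Otimes>\<^sub>M borel)) (\<lambda>w. R (fst w) (fst (snd w))
      (snd (snd w)))"
    using R by (simp add: split_beta')
  have f: "(\<lambda>(x, s, z). f x s z) \<in> borel_measurable (borel \<Otimes>\<^sub>M (borel \<Otimes>\<^sub>M borel))"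
  proof -
    have "(\<lambda>(x, s, z). f x s z) = (\<lambda>(x, s, z). if R x s z then ennreal (c s) else 0)"
      by (auto simp: f_def indicator_def fun_eq_iff)
    also have "\<dots> \<in> borel_measurable (borel \<Otimes>\<^sub>M (borel \<Otimes>\<^sub>M borel))" by measurable
    finally show ?thesis .
  qed
  have [measurable (raw)]: "(\<lambda>w. f (g w) (h w) (k w)) \<in> borel_measurable N"
    if [measurable]: "g \<in> measurable N borel" "h \<in> measurable N borel" "k \<in> measurable N borel"
    for N :: "'c measure" and g h k
    using measurable_compose[OF _ f, of "\<lambda>w. (g w, h w, k w)" N] by simp
  interpret MM: pair_sigma_finite M M ..
  have 1: "scale_measure (gap_set e E Z \<inter> scales_below r) x * indicator (Z \<inter> ball p r) x
    \<le> (\<integral>\<^sup>+s. \<integral>\<^sup>+z. f x s z \<partial>M \<partial>log_measure)" for x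
  proof (cases "x \<in> Z \<inter> ball p r")
    case True
    from AE_log_measure_pos have "AE s in log_measure. indicator (gap_set e E Z \<inter> scales_below r)
        (x, s) \<le> (\<integral>\<^sup>+z. f x s z \<partial>M)"
    proof eventually_elim
      case (elim s)
      show ?case
      proof (cases "(x, s) \<in> gap_set e E Z \<and> s < r")
        case gap: True
        have "{z. R x s z} = {z. dist x z < 3 * s \<and> e * s / 2 \<le> infdist z Z \<and> infdist z Z \<le> 3 * s}"
          using True gap elim by (auto simp: R_def)
        moreover have "{z. R x s z} \<in> sets M" using R by measurable
        ultimately show ?thesis
          using gap_set_witness[OF e, of x Z s] True gap elim
          by (simp add: f_def c_def nn_integral_cmult_indicator)
      qed (auto simp: indicator_def)
    qed
    then have "scale_measure (gap_set e E Z \<inter> scales_below r) x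
        \<le> (\<integral>\<^sup>+s. \<integral>\<^sup>+z. f x s z \<partial>M \<partial>log_measure)"
      by (subst scale_measure_nn_integral) (auto intro: nn_integral_mono_AE)
    then show ?thesis using True by simp
  qed auto
  have 2: "(\<integral>\<^sup>+s. \<integral>\<^sup>+x. f x s z \<partial>M \<partial>log_measure)
     \<le> ennreal (C\<^sup>2 * (6 / e) ^ Q * ln (6 / e)) * indicator (ball p (4 * r)) z" (is "?I \<le> _")
    if z: "z \<in> E" for z
  proof (cases "0 < infdist z Z \<and> z \<in> ball p (4 * r)")
    case False
    have "f x s z = 0" for x s
    proof -
      have "\<not> R x s z"
      proof
        assume R: "R x s z"
        then have "0 < e * s / 2" using e by (simp add: R_def)
        with R have "0 < infdist z Z" unfolding R_def by linarith
        moreover have "dist p z < 4 * r" using R dist_triangle[of p z x] unfolding R_def by linarith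
        ultimately show False using False by simp
      qed
      then show ?thesis by (simp add: f_def)
    qed
    then show ?thesis by simp
  next
    case True
    define d where "d = infdist z Z"
    have d: "0 < d" using True by (simp add: d_def)
    \<comment> \<open>The two bounds on the distance d from z to \<open>Z\<close> confine s to this
      interval. Since x stays in the ball of radius 3 s around z, the growth of its measure cancels
      the power of s in \<open>c s\<close>.\<close>
    have "(\<integral>\<^sup>+x. f x s z \<partial>M) \<le> ennreal (C\<^sup>2 * (6 / e) ^ Q) * indicator {d / 3..2 * d / e} s" for s
    proof (cases "0 < s \<and> s \<in> {d / 3..2 * d / e}")
      case s: True
      have "(\<integral>\<^sup>+x. f x s z \<partial>M) \<le> (\<integral>\<^sup>+x. ennreal (c s) * indicator (ball z (3 * s)) x \<partial>M)"
        by (intro nn_integral_mono) (auto simp: f_def R_def indicator_def dist_commute)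
      also have "\<dots> = ennreal (c s) * emeasure M (ball z (3 * s))"
        by (intro nn_integral_cmult_indicator) (simp add: sets_M)
      also have "\<dots> \<le> ennreal (c s) * ennreal (C * (3 * s) ^ Q)"
        using z s by (intro mult_left_mono ball_upper) auto
      also have "\<dots> = ennreal (c s * (C * (3 * s) ^ Q))"
        using s e C_ge_1 by (intro ennreal_mult[symmetric]) (auto simp: c_def)
      also have "c s * (C * (3 * s) ^ Q) = C\<^sup>2 * (2 / (e * s) * (3 * s)) ^ Q"
        unfolding power_mult_distrib by (simp add: c_def power2_eq_square)
      also have "2 / (e * s) * (3 * s) = 6 / e" using s e by (simp add: field_simps)
      finally show ?thesis using s by simp
    next
      case s: False
      have "\<not> R x s z" for x
      proof
        assume R: "R x s z"
        then have "s \<le> 2 * d / e" "d / 3 \<le> s" using e by (auto simp: R_def d_def field_simps)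
        then show False using s R by (simp add: R_def)
      qed
      then have "f x s z = 0" for x by (simp add: f_def)
      then show ?thesis by simp
    qed
    then have "?I \<le> (\<integral>\<^sup>+s. ennreal (C\<^sup>2 * (6 / e) ^ Q) * indicator {d / 3..2 * d / e} s
        \<partial>log_measure)"
      by (intro nn_integral_mono)
    also have "\<dots> = ennreal (C\<^sup>2 * (6 / e) ^ Q) * emeasure log_measure {d / 3..2 * d / e}"
      by (intro nn_integral_cmult_indicator) simp
    also have "emeasure log_measure {d / 3..2 * d / e} = ennreal (ln (2 * d / e / (d / 3)))"
      using d e by (intro emeasure_log_measure_Icc) (auto simp: field_simps)
    also have "2 * d / e / (d / 3) = 6 / e" using d e by (simp add: field_simps)
    also have "ennreal (C\<^sup>2 * (6 / e) ^ Q) * ennreal (ln (6 / e))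
        = ennreal (C\<^sup>2 * (6 / e) ^ Q * ln (6 / e))"
      using e C_ge_1 by (intro ennreal_mult[symmetric]) auto
    finally show ?thesis using True by simp
  qed
  have "(\<integral>\<^sup>+x\<in>Z \<inter> ball p r. scale_measure (gap_set e E Z \<inter> scales_below r) x \<partial>M)
      \<le> (\<integral>\<^sup>+x. \<integral>\<^sup>+s. \<integral>\<^sup>+z. f x s z \<partial>M \<partial>log_measure \<partial>M)"
    by (intro nn_integral_mono 1)
  also have "\<dots> = (\<integral>\<^sup>+x. \<integral>\<^sup>+z. \<integral>\<^sup>+s. f x s z \<partial>log_measure \<partial>M \<partial>M)"
    by (intro nn_integral_cong scale_pair.Fubini') measurable
  also have "\<dots> = (\<integral>\<^sup>+z. \<integral>\<^sup>+x. \<integral>\<^sup>+s. f x s z \<partial>log_measure \<partial>M \<partial>M)"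
    by (intro MM.Fubini') measurable
  also have "\<dots> = (\<integral>\<^sup>+z. \<integral>\<^sup>+s. \<integral>\<^sup>+x. f x s z \<partial>M \<partial>log_measure \<partial>M)"
    by (intro nn_integral_cong scale_pair.Fubini'[symmetric]) measurable
  also have "\<dots> \<le> (\<integral>\<^sup>+z. ennreal (C\<^sup>2 * (6 / e) ^ Q * ln (6 / e)) * indicator (ball p (4 * r)) z \<partial>M)"
    using AE_E by (intro nn_integral_mono_AE) (auto elim!: eventually_mono intro: 2)
  also have "\<dots> = ennreal (C\<^sup>2 * (6 / e) ^ Q * ln (6 / e)) * emeasure M (ball p (4 * r))"
    by (intro nn_integral_cmult_indicator) (simp add: sets_M)
  also have "\<dots> \<le> ennreal (C\<^sup>2 * (6 / e) ^ Q * ln (6 / e)) * ennreal (C * (4 * r) ^ Q)"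
    using p r by (intro mult_left_mono ball_upper) auto
  also have "\<dots> = ennreal (C\<^sup>2 * (6 / e) ^ Q * ln (6 / e) * (C * (4 * r) ^ Q))"
    using e r C_ge_1 by (intro ennreal_mult[symmetric]) auto
  also have "C\<^sup>2 * (6 / e) ^ Q * ln (6 / e) * (C * (4 * r) ^ Q)
      = C ^ 3 * (6 / e * (4 * r)) ^ Q * ln (6 / e)"
    unfolding power_mult_distrib[of "6 / e" "4 * r"] by (simp add: power2_eq_square power3_eq_cube)
  also have "6 / e * (4 * r) = 24 / e * r" by simp
  also have "C ^ 3 * (24 / e * r) ^ Q * ln (6 / e) = gap_const C Q e * r ^ Q"
    unfolding power_mult_distrib by (simp add: gap_const_def)
  finally show ?thesis .
qed

lemma scale_measure_Fubini:
  assumes A [measurable]: "A \<in> sets borel"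
  shows "(\<integral>\<^sup>+s. (\<integral>\<^sup>+x. indicator A (x, s) * indicator (ball p r) x \<partial>M) * indicator {..<r} s
      \<partial>log_measure)
    = (\<integral>\<^sup>+x\<in>ball p r. scale_measure (A \<inter> scales_below r) x \<partial>M)"
proof -
  have AP [measurable]: "A \<in> sets (borel \<Otimes>\<^sub>M borel)" unfolding borel_prod by (rule A)
  have [measurable]: "ball p r \<in> sets borel" by simp
  have sec: "Pair x -` (A \<inter> scales_below r) \<in> sets borel" for x
    by (intro Pair_vimage_borel) measurable
  have "(\<integral>\<^sup>+s. (\<integral>\<^sup>+x. indicator A (x, s) * indicator (ball p r) x \<partial>M) * indicator {..<r} s
      \<partial>log_measure)
      = (\<integral>\<^sup>+s. \<integral>\<^sup>+x. indicator A (x, s) * indicator (ball p r) x * indicator {..<r} s \<partial>M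
          \<partial>log_measure)"
    by (intro nn_integral_cong nn_integral_multc[symmetric]) measurable
  also have "\<dots> = (\<integral>\<^sup>+x. \<integral>\<^sup>+s. indicator A (x, s) * indicator (ball p r) x * indicator {..<r} s
      \<partial>log_measure \<partial>M)"
    by (intro scale_pair.Fubini') measurable
  also have "\<dots> = (\<integral>\<^sup>+x\<in>ball p r. scale_measure (A \<inter> scales_below r) x \<partial>M)"
  proof (intro nn_integral_cong)
    fix x
    have "(\<lambda>s. indicator A (x, s) * indicator (ball p r) x * indicator {..<r} s)
        = (\<lambda>s. indicator (ball p r) x * indicator (Pair x -` (A \<inter> scales_below r)) s :: ennreal)"
      by (auto simp: indicator_def fun_eq_iff)
    then show "(\<integral>\<^sup>+s. indicator A (x, s) * indicator (ball p r) x * indicator {..<r} s \<partial>log_measure)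
        = scale_measure (A \<inter> scales_below r) x * indicator (ball p r) x"
      using sec[of x] by (simp add: scale_measure_def nn_integral_cmult_indicator mult.commute)
  qed
  finally show ?thesis .
qed

end

section \<open>Carleson estimates from big good parts\<close>

text \<open>Greedy selection: keep a ball of largest radius and discard all balls that meet it,
  which its triple covers; then continue with the balls that are left.\<close>

lemma finite_vitali:
  fixes a :: "'i \<Rightarrow> 'a::metric_space"
  assumes "finite I" "\<And>i. i \<in> I \<Longrightarrow> 0 < r i"
  shows "\<exists>J\<subseteq>I. disjoint_family_on (\<lambda>j. ball (a j) (r j)) J \<and>
    (\<Union>i\<in>I. ball (a i) (r i)) \<subseteq> (\<Union>j\<in>J. ball (a j) (3 * r j))"
  using assms
proof (induction I rule: finite_psubset_induct)
  case (psubset I)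
  show ?case
  proof (cases "I = {}")
    case False
    then have "Max (r ` I) \<in> r ` I" using psubset.hyps by (intro Max_in) auto
    then obtain i0 where i0: "i0 \<in> I" "r i0 = Max (r ` I)" by auto
    have le: "r i \<le> r i0" if "i \<in> I" for i using psubset.hyps that i0 by simp
    define I' where "I' = {i \<in> I. ball (a i) (r i) \<inter> ball (a i0) (r i0) = {}}"
    \<comment> \<open>The chosen ball is nonempty and hence meets itself, so that \<open>I'\<close>
      really is smaller than \<open>I\<close>.\<close>
    have "a i0 \<in> ball (a i0) (r i0)" using psubset.prems[OF i0(1)] by simp
    then have "I' \<subset> I" using i0 unfolding I'_def by blast
    then obtain J where J: "J \<subseteq> I'" "disjoint_family_on (\<lambda>j. ball (a j) (r j)) J"
        "(\<Union>i\<in>I'. ball (a i) (r i)) \<subseteq> (\<Union>j\<in>J. ball (a j) (3 * r j))"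
      using psubset.IH psubset.prems by (metis (no_types, lifting) psubsetD)
    have "disjoint_family_on (\<lambda>j. ball (a j) (r j)) (insert i0 J)"
      using J(1,2) unfolding disjoint_family_on_def I'_def by blast
    moreover have "ball (a i) (r i) \<subseteq> (\<Union>j\<in>insert i0 J. ball (a j) (3 * r j))" if "i \<in> I" for i
    proof (cases "i \<in> I'")
      case False
      then obtain y where y: "dist (a i) y < r i" "dist (a i0) y < r i0" using \<open>i \<in> I\<close>
          by (auto simp: I'_def)
      have "dist (a i0) z < 3 * r i0" if "dist (a i) z < r i" for z
        using y that le[OF \<open>i \<in> I\<close>] dist_triangle[of "a i0" z y] dist_triangle[of y z "a i"]
        by (simp add: dist_commute)
      then show ?thesis by auto
    qed (use J in blast)
    ultimately show ?thesis using J(1) i0 by (intro exI[of _ "insert i0 J"]) (auto simp: I'_def)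
  qed (simp add: disjoint_family_on_def)
qed

section \<open>Tents and the closedness of sets of good points\<close>

definition tent :: "'a::metric_space set \<Rightarrow> ('a \<times> real) set" where
  "tent U = {(x, s). ball x s \<subseteq> U}"

lemma mem_tent: "(x, s) \<in> tent U \<longleftrightarrow> ball x s \<subseteq> U"
  by (simp add: tent_def)

lemma tent_borel [measurable]: "tent U \<in> sets borel"
proof -
  have "- tent U = (\<Union>y\<in>-U. {z. dist (fst z) y < snd z})"
    by (auto simp: tent_def)
  also have "open \<dots>" by (intro open_UN ballI open_Collect_less continuous_intros)
  finally show ?thesis by (intro borel_closed) (simp add: closed_def)
qed

text \<open>For \<open>U = UNIV\<close> the right-hand side would be \<open>infdist x {}\<close>,
  which is 0 by convention, while the tent contains all scales. This is why \<open>UNIV\<close> is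
  excluded from tent estimates throughout.\<close>

lemma tent_le_infdist:
  assumes "(x, s) \<in> tent U" "U \<noteq> UNIV"
  shows "s \<le> infdist x (- U)"
proof -
  have "s \<le> dist x y" if "y \<in> - U" for y
    using assms(1) that by (force simp: tent_def)
  then show ?thesis using assms(2) by (auto simp: infdist_def intro!: cINF_greatest)
qed

lemma infdist_tent: "(x, infdist x (- U)) \<in> tent U"
  using infdist_le[of _ "- U" x] by (force simp: tent_def)

text \<open>The indicator of an open set is lower semicontinuous in x for each fixed scale, and
  Fatou's lemma passes this on to the integral over scales.\<close>

lemma closed_scale_measure_le:
  fixes W :: "('a::{metric_space, second_countable_topology} \<times> real) set"
  assumes W: "open W"
  shows "closed {x. scale_measure W x \<le> c}"
  unfolding closed_sequential_limits
proof (intro allI impI, elim conjE, rule CollectI)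
  fix f x assume f: "\<forall>n. f n \<in> {x. scale_measure W x \<le> c}" "f \<longlonglongrightarrow> x"
  have W' [measurable]: "W \<in> sets borel" using W by (rule borel_open)
  have [measurable]: "(\<lambda>s. indicator W (y, s) :: ennreal) \<in> borel_measurable log_measure" for y
  proof -
    have "(\<lambda>s. indicator W (y, s) :: ennreal) = indicator (Pair y -` W)"
        by (auto simp: indicator_def fun_eq_iff)
    then show ?thesis by simp
  qed
  have "indicator W (x, s) \<le> liminf (\<lambda>n. indicator W (f n, s) :: ennreal)" for s
  proof (cases "(x, s) \<in> W")
    case True
    have "(\<lambda>n. (f n, s)) \<longlonglongrightarrow> (x, s)" by (intro tendsto_Pair f tendsto_const)
    then have "\<forall>\<^sub>F n in sequentially. (f n, s) \<in> W" using W True by (rule topological_tendstoD)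
    then have "\<forall>\<^sub>F n in sequentially. 1 \<le> (indicator W (f n, s) :: ennreal)"
      by (rule eventually_mono) simp
    then have "1 \<le> liminf (\<lambda>n. indicator W (f n, s) :: ennreal)" by (rule Liminf_bounded)
    then show ?thesis using True by simp
  qed simp
  then have "scale_measure W x \<le> (\<integral>\<^sup>+s. liminf (\<lambda>n. indicator W (f n, s)) \<partial>log_measure)"
    unfolding scale_measure_nn_integral[OF W'] by (intro nn_integral_mono)
  also have "\<dots> \<le> liminf (\<lambda>n. \<integral>\<^sup>+s. indicator W (f n, s) \<partial>log_measure)"
    by (intro nn_integral_liminf) measurable
  also have "\<dots> = liminf (\<lambda>n. scale_measure W (f n))"
    by (simp add: scale_measure_nn_integral[OF W'])
  also have "\<dots> \<le> liminf (\<lambda>n::nat. c)"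
    using f(1) by (intro Liminf_mono always_eventually) auto
  finally show "scale_measure W x \<le> c" by (simp add: Liminf_const)
qed

text \<open>The 2 pays for replacing an open set by a compact part of it, \<open>6 ^ Q\<close> for
  the ratio between the covering radius 3 \<rho> and the radius \<rho> / 2 where good points are
  taken, and \<open>C\<close> for the upper bound on the covering balls.\<close>

definition good_fraction :: "real \<Rightarrow> nat \<Rightarrow> real \<Rightarrow> real" where
  "good_fraction C Q \<eta> = \<eta> / (2 * C * 6 ^ Q)"

text \<open>The fixed point of the map K |-> (1 - \<eta>') K + (m + ln 56), where \<eta>' is the
  good fraction.\<close>

definition tent_const :: "real \<Rightarrow> nat \<Rightarrow> real \<Rightarrow> real \<Rightarrow> real" where
  "tent_const C Q \<eta> m = (m + ln 56) / good_fraction C Q \<eta>"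

text \<open>\<open>W\<close> stands for the scales that are bad at half the threshold, extended to
  an open set. Unboundedness of the space ensures that no ball is all of \<open>UNIV\<close>, so
  that tents over balls are admissible.\<close>

locale big_good_parts = ahlfors_measure M E C Q
  for M :: "'a::{heine_borel, second_countable_topology} measure" and E C Q +
  fixes W :: "('a \<times> real) set" and \<eta> m :: real
  assumes unbounded: "\<not> bounded (UNIV :: 'a set)"
    and open_W: "open W"
    and eta: "0 < \<eta>" "\<eta> \<le> 1" and m_nonneg: "0 \<le> m"
    and good: "\<And>p r. p \<in> E \<Longrightarrow> 0 < r \<Longrightarrow> ennreal (\<eta> * r ^ Q) \<le>
      emeasure M (E \<inter> ball p r \<inter> {x. scale_measure (W \<inter> scales_below r) x \<le> ennreal m})"
begin

abbreviation "\<eta>' \<equiv> good_fraction C Q \<eta>"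

lemma eta': "0 < \<eta>'" "\<eta>' \<le> 1"
proof -
  have "1 * 1 * 1 \<le> 2 * C * 6 ^ Q" using C_ge_1 by (intro mult_mono) auto
  then show "0 < \<eta>'" "\<eta>' \<le> 1" using eta C_ge_1 by (auto simp: good_fraction_def divide_simps)
qed

lemma open_W_below: "open (W \<inter> scales_below r)"
  unfolding scales_below_def by (intro open_Int open_W open_Times) auto

text \<open>The radii of the Vitali balls are proportional to the distance to the complement of
  \<open>U\<close>. This keeps the balls inside \<open>U\<close> and bounds the distance from a good
  point to the complement by a multiple of the scale below which the point is good.\<close>

lemma good_compact:
  assumes U: "open U" "bounded U" "U \<noteq> UNIV"
  shows "\<exists>F. compact F \<and> F \<subseteq> E \<and> F \<subseteq> U \<and> ennreal \<eta>' * emeasure M U \<le> emeasure M F \<and>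
    (\<forall>x\<in>F. \<exists>\<rho>>0. scale_measure (W \<inter> scales_below \<rho>) x \<le> ennreal m \<and> infdist x (- U) \<le> 21 * \<rho>)"
proof (cases "emeasure M U = 0")
  case True
  then show ?thesis by (intro exI[of _ "{}"]) auto
next
  case False
  have U' [measurable]: "U \<in> sets borel" using U by auto
  have fin: "emeasure M U < \<infinity>" by (intro emeasure_bounded_finite U U')
  have ne: "- U \<noteq> {}" using U by auto
  define D where "D x = infdist x (- U)" for x
  have D_pos: "0 < D x \<longleftrightarrow> x \<in> U" for x
    using infdist_pos_not_in_closed[of "- U" x] infdist_nonneg[of x "- U"] ne U
    by (cases "x \<in> U") (auto simp: D_def)
  have D_lip: "D x \<le> D y + dist x y" for x y unfolding D_def by (rule infdist_triangle)
  \<comment> \<open>Compact sets exhausting \<open>E \<inter> U\<close>; one that carries half the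
    measure of \<open>U\<close> is covered by finitely many balls.\<close>
  define K where "K n = E \<inter> {x. 1 / real (Suc n) \<le> D x}" for n
  have K_closed: "closed (K n)" for n
    unfolding K_def D_def by (intro closed_Int closed_E closed_Collect_le continuous_intros)
  have K_sub: "K n \<subseteq> U" for n
  proof
    fix x assume "x \<in> K n"
    then have "1 / real (Suc n) \<le> D x" by (simp add: K_def)
    moreover have "0 < 1 / real (Suc n)" by simp
    ultimately have "0 < D x" by linarith
    then show "x \<in> U" using D_pos by simp
  qed
  have "incseq K"
  proof (rule incseq_SucI)
    fix n show "K n \<subseteq> K (Suc n)"
      unfolding K_def by (auto intro: order_trans[rotated] simp: frac_le)
  qed
  moreover have "(\<Union>n. K n) = E \<inter> U"
  proof
    show "(\<Union>n. K n) \<subseteq> E \<inter> U" using K_sub by (auto simp: K_def)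
    show "E \<inter> U \<subseteq> (\<Union>n. K n)"
    proof
      fix x assume x: "x \<in> E \<inter> U"
      then have "0 < D x" using D_pos by simp
      then obtain n where "1 / real (Suc n) < D x" by (rule nat_approx_posE)
      then show "x \<in> (\<Union>n. K n)" using x by (auto simp: K_def intro: less_imp_le)
    qed
  qed
  ultimately have "(\<lambda>n. emeasure M (K n)) \<longlonglongrightarrow> emeasure M (E \<inter> U)"
    using Lim_emeasure_incseq[of K M] borel_closed[OF K_closed]
        by (simp add: sets_M image_subset_iff)
  also have "emeasure M (E \<inter> U) = emeasure M U"
    using AE_E by (intro emeasure_eq_AE) (auto simp: sets_M elim: eventually_mono)
  finally have lim: "(\<lambda>n. emeasure M (K n)) \<longlonglongrightarrow> emeasure M U" .
  \<comment> \<open>Strict because the measure is neither 0 nor infinite; measure 0 was split off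
    for this reason.\<close>
  have "ennreal (1 / 2) * emeasure M U < emeasure M U"
  proof -
    obtain u where u: "emeasure M U = ennreal u" "0 < u"
      using False fin by (cases "emeasure M U") auto
    then have "ennreal (1 / 2) * emeasure M U = ennreal (1 / 2 * u)"
      unfolding u(1) by (intro ennreal_mult[symmetric]) auto
    also have "\<dots> < emeasure M U" unfolding u(1) using u(2) by (intro ennreal_lessI) auto
    finally show ?thesis .
  qed
  from order_tendstoD(1)[OF lim this] obtain n where n: "ennreal (1 / 2) * emeasure M U
      < emeasure M (K n)"
    by (auto simp: eventually_sequentially)
  define \<rho> where "\<rho> q = D q / 10" for q
  have K_compact: "compact (K n)"
    using K_closed bounded_subset[OF U(2) K_sub] by (simp add: compact_eq_bounded_closed)
  have K_cover: "K n \<subseteq> (\<Union>q\<in>K n. ball q (\<rho> q))"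
  proof
    fix x assume x: "x \<in> K n"
    then have "0 < D x" using K_sub[of n] D_pos by blast
    then have "x \<in> ball x (\<rho> x)" by (simp add: \<rho>_def)
    then show "x \<in> (\<Union>q\<in>K n. ball q (\<rho> q))" using x by blast
  qed
  obtain I where I: "I \<subseteq> K n" "finite I" "K n \<subseteq> (\<Union>q\<in>I. ball q (\<rho> q))"
    by (rule compactE_image[OF K_compact _ K_cover]) auto
  have \<rho>_pos: "0 < \<rho> q" if "q \<in> I" for q
    using that I(1) K_sub[of n] D_pos[of q] by (auto simp: \<rho>_def)
  obtain J where J: "J \<subseteq> I" "disjoint_family_on (\<lambda>q. ball q (\<rho> q)) J"
      "(\<Union>q\<in>I. ball q (\<rho> q)) \<subseteq> (\<Union>q\<in>J. ball q (3 * \<rho> q))"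
    using finite_vitali[OF I(2), of \<rho> "\<lambda>q. q"] \<rho>_pos by auto
  have finJ: "finite J" using J(1) I(2) by (rule finite_subset)
  have JE: "q \<in> E" "q \<in> U" "0 < \<rho> q" if "q \<in> J" for q
  proof -
    have "q \<in> K n" "q \<in> I" using that J(1) I(1) by auto
    then show "q \<in> E" "q \<in> U" "0 < \<rho> q" using K_sub[of n] \<rho>_pos by (auto simp: K_def)
  qed
  \<comment> \<open>A closed ball of half the radius: it gives a closed set and still lies in the
    open ball of radius \<open>\<rho> q\<close>, so disjointness is inherited.\<close>
  define F where "F q = E \<inter> cball q (\<rho> q / 2) \<inter> {x. scale_measure (W \<inter> scales_below (\<rho> q / 2)) x
      \<le> ennreal m}" for q
  have F_closed: "closed (F q)" for q
    unfolding F_def by (intro closed_Int closed_E closed_cball closed_scale_measure_le open_W_below)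
  have F_sub: "F q \<subseteq> ball q (\<rho> q)" if "q \<in> J" for q
    using JE(3)[OF that] by (auto simp: F_def)
  have F_compact: "compact (F q)" for q
    using F_closed[of q] bounded_subset[OF bounded_cball[of q "\<rho> q / 2"], of "F q"]
    by (auto simp: compact_eq_bounded_closed F_def)
  have in_U: "ball q (\<rho> q) \<subseteq> U" if "q \<in> J" for q
    using infdist_tent[of q U] JE(3)[OF that] by (auto simp: mem_tent \<rho>_def D_def[symmetric])
  have "ennreal \<eta>' * emeasure M U = ennreal (\<eta> / (C * 6 ^ Q)) * (ennreal (1 / 2) * emeasure M U)"
  proof -
    have "\<eta>' = \<eta> / (C * 6 ^ Q) * (1 / 2)" by (simp add: good_fraction_def)
    then have "ennreal \<eta>' = ennreal (\<eta> / (C * 6 ^ Q)) * ennreal (1 / 2)"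
      using eta C_ge_1 by (simp only:, intro ennreal_mult) auto
    then show ?thesis by (simp only: mult.assoc)
  qed
  also have "\<dots> \<le> ennreal (\<eta> / (C * 6 ^ Q)) * emeasure M (\<Union>q\<in>J. ball q (3 * \<rho> q))"
    using order_trans[OF I(3) J(3)]
    by (intro mult_left_mono order_trans[OF less_imp_le[OF n]] emeasure_mono) (auto simp: sets_M
        intro!: borel_open)
  also have "\<dots> \<le> ennreal (\<eta> / (C * 6 ^ Q)) * (\<Sum>q\<in>J. emeasure M (ball q (3 * \<rho> q)))"
    using finJ by (intro mult_left_mono emeasure_subadditive_finite) (auto simp: sets_M)
  also have "\<dots> \<le> ennreal (\<eta> / (C * 6 ^ Q)) * (\<Sum>q\<in>J. ennreal (C * (3 * \<rho> q) ^ Q))"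
    using JE by (intro mult_left_mono sum_mono ball_upper) auto
  also have "\<dots> = (\<Sum>q\<in>J. ennreal (\<eta> * (\<rho> q / 2) ^ Q))"
    unfolding sum_distrib_left
  proof (intro sum.cong refl)
    fix q assume "q \<in> J"
    then have "0 < \<rho> q" by (rule JE)
    then have "ennreal (\<eta> / (C * 6 ^ Q)) * ennreal (C * (3 * \<rho> q) ^ Q)
        = ennreal (\<eta> / (C * 6 ^ Q) * (C * (3 * \<rho> q) ^ Q))"
      using eta C_ge_1 by (intro ennreal_mult[symmetric]) auto
    also have "\<eta> / (C * 6 ^ Q) * (C * (3 * \<rho> q) ^ Q) = \<eta> * (3 * \<rho> q / 6) ^ Q"
      unfolding power_divide[of "3 * \<rho> q"] using C_ge_1 by simp
    also have "3 * \<rho> q / 6 = \<rho> q / 2" by simp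
    finally show "ennreal (\<eta> / (C * 6 ^ Q)) * ennreal (C * (3 * \<rho> q) ^ Q)
        = ennreal (\<eta> * (\<rho> q / 2) ^ Q)" .
  qed
  also have "\<dots> \<le> (\<Sum>q\<in>J. emeasure M (F q))"
  proof (intro sum_mono)
    fix q assume "q \<in> J"
    then have "ennreal (\<eta> * (\<rho> q / 2) ^ Q) \<le> emeasure M (E \<inter> ball q (\<rho> q / 2) \<inter>
        {x. scale_measure (W \<inter> scales_below (\<rho> q / 2)) x \<le> ennreal m})"
      using JE by (intro good) auto
    also have "\<dots> \<le> emeasure M (F q)"
      using F_closed by (intro emeasure_mono) (auto simp: F_def sets_M)
    finally show "ennreal (\<eta> * (\<rho> q / 2) ^ Q) \<le> emeasure M (F q)" .
  qed
  also have "\<dots> = emeasure M (\<Union>q\<in>J. F q)"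
    using F_closed finJ J(2) F_sub
    by (intro sum_emeasure) (auto simp: sets_M disjoint_family_on_def, blast)
  finally have "ennreal \<eta>' * emeasure M U \<le> emeasure M (\<Union>q\<in>J. F q)" .
  \<comment> \<open>The witness is \<open>\<rho> q / 2\<close>, that is \<open>D q / 20\<close>. As
    x is that close to q, its distance to the complement is at most (1 + 1 / 20) \<open>D q\<close>,
    which is 21 times the witness.\<close>
  moreover have "\<exists>\<rho>>0. scale_measure (W \<inter> scales_below \<rho>) x \<le> ennreal m \<and> infdist x (- U) \<le> 21 * \<rho>"
    if "q \<in> J" "x \<in> F q" for q x
    using that JE(3)[OF that(1)] D_lip[of x q]
    by (intro exI[of _ "\<rho> q / 2"]) (auto simp: F_def D_def[symmetric] \<rho>_def dist_commute)
  moreover have "F q \<subseteq> E" for q by (auto simp: F_def)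
  ultimately show ?thesis
    using F_compact finJ F_sub in_U
    by (intro exI[of _ "\<Union>q\<in>J. F q"]) (auto intro!: compact_UN, blast)
qed

text \<open>For beta-numbers this reflects that the ball of radius s around q lies in the ball of
  radius 2 s around x. The property passes to subsets of \<open>A\<close>, as the truncation of
  scales requires.\<close>

definition transfers :: "('a \<times> real) set \<Rightarrow> bool" where
  "transfers A \<longleftrightarrow> (\<forall>x\<in>E. \<forall>q s. (q, s) \<in> A \<longrightarrow> 0 < s \<longrightarrow> dist q x \<le> s \<longrightarrow> (x, 2 * s) \<in> W)"

lemma scale_measure_outside:
  fixes U :: "'a set"
  assumes "x \<notin> U"
  shows "scale_measure (A \<inter> tent U) x = 0"
proof -
  have "scale_measure (A \<inter> tent U) x \<le> scale_measure {} x"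
  proof (rule scale_measure_mono)
    fix s :: real assume "0 < s" "(x, s) \<in> A \<inter> tent U"
    then have "x \<in> U" using centre_in_ball[of x s] by (auto simp: mem_tent)
    then show "(x, s) \<in> {}" using assms by simp
  qed simp
  then show ?thesis by (simp add: scale_measure_def)
qed

text \<open>
  At a scale \<open>s\<close> where the ball around \<open>q\<close> meets \<open>F\<close>, badness is inherited, at scale \<open>2 s\<close>, by the
  point of \<open>F\<close> nearest to \<open>q\<close>, which has few bad scales below \<open>\<rho>\<close>. The two bands of scales that
  this misses have ratios 14 and 4, whence \<open>ln 56\<close>.
\<close>

lemma scale_measure_split:
  assumes A [measurable]: "A \<in> sets borel" and tr: "transfers A"
    and U: "open U" "U \<noteq> UNIV" and q: "q \<in> E" "q \<in> U"
    and F: "compact F" "F \<subseteq> E" "F \<noteq> {}"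
    and F_good: "\<forall>x\<in>F. \<exists>\<rho>>0. scale_measure (W \<inter> scales_below \<rho>) x \<le> ennreal m \<and> infdist x (- U)
        \<le> 21 * \<rho>"
  shows "scale_measure (A \<inter> tent U) q \<le> scale_measure (A \<inter> tent (U - F)) q + ennreal (m + ln 56)"
proof -
  define D where "D = infdist q (- U)"
  have D: "0 < D"
    using infdist_pos_not_in_closed[of "- U" q] U q by (auto simp: D_def)
  obtain x where x: "x \<in> F" "infdist q F = dist q x"
    using infdist_attains_inf[OF compact_imp_closed[OF F(1)] F(3)] by metis
  then obtain \<rho> where \<rho>: "0 < \<rho>" "scale_measure (W \<inter> scales_below \<rho>) x
      \<le> ennreal m" "infdist x (- U) \<le> 21 * \<rho>"
    using F_good by blast
  define B where "B = Pair x -` (W \<inter> scales_below \<rho>)"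
  have B [measurable]: "B \<in> sets borel"
    unfolding B_def by (intro Pair_vimage_borel borel_open open_W_below)
  have B2 [measurable]: "(*) 2 -` B \<in> sets borel"
    by (rule measurable_sets_borel[of _ borel]) (use B in auto)
  have cover: "s \<in> Pair q -` (A \<inter> tent (U - F)) \<union> ((*) 2 -` B \<union> ({\<rho> / 2..7 * \<rho>} \<union> {D / 4..D}))"
    if s: "0 < s" "(q, s) \<in> A" "(q, s) \<in> tent U" for s
  proof (cases "ball q s \<inter> F = {}")
    case True
    then show ?thesis using s by (auto simp: mem_tent)
  next
    case False
    then obtain z where "z \<in> F" "dist q z < s" by auto
    then have d: "dist q x < s" using x infdist_le[of z F q] by auto
    then have W: "(x, 2 * s) \<in> W" using tr s x F(2) by (auto simp: transfers_def)
    have "s \<le> D" using tent_le_infdist[OF s(3)] U by (simp add: D_def)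
    show ?thesis
    proof (cases "s < D / 4")
      case True
      \<comment> \<open>With \<open>dist q x\<close> < s < D / 4 and the bound 21 \<rho> this gives
        3 D / 4 < 21 \<rho>, so s < 7 \<rho>. If moreover s < \<rho> / 2, then 2 s is one of the few
        bad scales of x; otherwise s lies in the first band.\<close>
      have "D \<le> infdist x (- U) + dist q x" unfolding D_def by (rule infdist_triangle)
      then have "s \<le> 7 * \<rho>" using True d \<rho>(3) by simp
      then show ?thesis using W by (auto simp: B_def)
    qed (use \<open>s \<le> D\<close> in auto)
  qed
  have "scale_measure (A \<inter> tent U) q \<le>
      emeasure log_measure (Pair q -` (A \<inter> tent (U - F)) \<union> ((*) 2 -` B \<union> ({\<rho> / 2..7 * \<rho>}
          \<union> {D / 4..D})))"
  proof -
    from AE_log_measure_pos show ?thesis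
      unfolding scale_measure_def
      by (intro emeasure_mono_AE) (auto elim!: eventually_mono dest: cover)
  qed
  also have "\<dots> \<le> scale_measure (A \<inter> tent (U - F)) q + (emeasure log_measure ((*) 2 -` B) +
      (emeasure log_measure {\<rho> / 2..7 * \<rho>} + emeasure log_measure {D / 4..D}))"
    unfolding scale_measure_def
    by (intro order_trans[OF emeasure_subadditive] add_left_mono) auto
  also have "emeasure log_measure ((*) 2 -` B) \<le> ennreal m"
    unfolding emeasure_log_measure_scale[OF zero_less_numeral B]
    using \<rho>(2) unfolding B_def scale_measure_def .
  also have "emeasure log_measure {\<rho> / 2..7 * \<rho>} = ennreal (ln 14)"
    using \<rho>(1) by (subst emeasure_log_measure_Icc) auto
  also have "emeasure log_measure {D / 4..D} = ennreal (ln 4)"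
    using D by (subst emeasure_log_measure_Icc) auto
  also have "ennreal m + (ennreal (ln 14) + ennreal (ln 4)) = ennreal (m + (ln 14 + ln 4))"
    using m_nonneg by (simp add: ennreal_plus)
  also have "ln 14 + ln 4 = ln (56 :: real)" by (subst ln_mult_pos[symmetric]) auto
  finally show ?thesis by (simp add: add_left_mono)
qed

text \<open>The Carleson condition tested on all proper bounded open sets: unlike the family of
  balls, this family is stable under removing a compact set.\<close>

definition tent_bound :: "('a \<times> real) set \<Rightarrow> real \<Rightarrow> bool" where
  "tent_bound A K \<longleftrightarrow> (\<forall>U. open U \<longrightarrow> bounded U \<longrightarrow> U \<noteq> UNIV \<longrightarrow>
     (\<integral>\<^sup>+x. scale_measure (A \<inter> tent U) x \<partial>M) \<le> ennreal K * emeasure M U)"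

lemma tent_boundD:
  "tent_bound A K \<Longrightarrow> open U \<Longrightarrow> bounded U \<Longrightarrow> U \<noteq> UNIV \<Longrightarrow>
    (\<integral>\<^sup>+x. scale_measure (A \<inter> tent U) x \<partial>M) \<le> ennreal K * emeasure M U"
  by (simp add: tent_bound_def)

text \<open>The assumed bound is applied to \<open>U - F\<close>, whose measure is smaller by the
  factor 1 - \<eta>'. Every scale not in its tent belongs to a ball that meets \<open>F\<close>, and
  at each point of \<open>U\<close> these scales have mass at most m + ln 56.\<close>

lemma tent_bound_improve:
  assumes A [measurable]: "A \<in> sets borel" and tr: "transfers A" and K: "0 \<le> K" "tent_bound A K"
  shows "tent_bound A ((1 - \<eta>') * K + (m + ln 56))"
  unfolding tent_bound_def
proof (intro allI impI)
  fix U :: "'a set" assume U: "open U" "bounded U" "U \<noteq> UNIV"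
  have [measurable]: "U \<in> sets borel" using U by auto
  define m' where "m' = m + ln 56"
  have m': "0 \<le> m'" using m_nonneg by (simp add: m'_def)
  obtain F where F: "compact F" "F \<subseteq> U" "ennreal \<eta>' * emeasure M U \<le> emeasure M F"
      "\<forall>x\<in>F. \<exists>\<rho>>0. scale_measure (W \<inter> scales_below \<rho>) x \<le> ennreal m \<and> infdist x (- U) \<le> 21 * \<rho>" "F
          \<subseteq> E"
    using good_compact[OF U] by blast
  have [measurable]: "F \<in> sets borel" using F(1) by (simp add: borel_compact)
  have fin: "emeasure M U < \<infinity>" using U by (intro emeasure_bounded_finite) auto
  have "AE x in M. scale_measure (A \<inter> tent U) x \<le> scale_measure (A \<inter> tent (U - F)) x
      + ennreal m' * indicator U x"
    using AE_E
  proof eventually_elim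
    case (elim q)
    \<comment> \<open>A nearest point exists only for nonempty \<open>F\<close>. If \<open>F\<close>
      is empty the two tents coincide, and outside \<open>U\<close> the tent has no positive
      scale.\<close>
    consider "q \<notin> U" | "F = {}" | "q \<in> U" "F \<noteq> {}" by blast
    then show ?case
    proof cases
      case 3
      then show ?thesis
        using scale_measure_split[OF A tr U(1,3) elim _ F(1,5) _ F(4)] by (simp add: m'_def)
    qed (auto simp: scale_measure_outside)
  qed
  then have "(\<integral>\<^sup>+x. scale_measure (A \<inter> tent U) x \<partial>M)
      \<le> (\<integral>\<^sup>+x. scale_measure (A \<inter> tent (U - F)) x + ennreal m' * indicator U x \<partial>M)"
    by (rule nn_integral_mono_AE)
  also have "\<dots> = (\<integral>\<^sup>+x. scale_measure (A \<inter> tent (U - F)) x \<partial>M) + ennreal m' * emeasure M U"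
    by (subst nn_integral_add) (auto simp: nn_integral_cmult_indicator sets_M)
  also have "(\<integral>\<^sup>+x. scale_measure (A \<inter> tent (U - F)) x \<partial>M) \<le> ennreal K * emeasure M (U - F)"
    using U F(1,2) by (intro tent_boundD[OF K(2)] open_Diff compact_imp_closed bounded_subset[OF
        U(2)]) auto
  also have "emeasure M (U - F) \<le> ennreal (1 - \<eta>') * emeasure M U"
  proof -
    obtain u where u: "emeasure M U = ennreal u" "0 \<le> u" using fin by (cases "emeasure M U") auto
    have "emeasure M F \<le> emeasure M U" using F(2) by (intro emeasure_mono) (auto simp: sets_M)
    then obtain f where f: "emeasure M F = ennreal f" "0 \<le> f" using u
        by (cases "emeasure M F") (auto simp: top_unique)
    have "emeasure M (U - F) = ennreal (u - f)"
      using F(2) f u by (subst emeasure_Diff) (auto simp: sets_M ennreal_minus)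
    moreover have "\<eta>' * u \<le> f"
      using F(3) eta' f u by (simp add: ennreal_mult[symmetric])
    ultimately show ?thesis
      using eta' u by (simp add: ennreal_mult[symmetric] algebra_simps ennreal_leI)
  qed
  also have "ennreal K * (ennreal (1 - \<eta>') * emeasure M U) + ennreal m' * emeasure M U
      = ennreal ((1 - \<eta>') * K + m') * emeasure M U"
  proof -
    have "ennreal ((1 - \<eta>') * K + m') = ennreal K * ennreal (1 - \<eta>') + ennreal m'"
      using K(1) eta' m' by (simp add: ennreal_plus ennreal_mult mult.commute)
    then show ?thesis by (simp only: distrib_right mult.assoc)
  qed
  finally show "(\<integral>\<^sup>+x. scale_measure (A \<inter> tent U) x \<partial>M) \<le> ennreal ((1 - \<eta>') * K + (m
      + ln 56)) * emeasure M U"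
    by (simp add: m'_def mult_left_mono add_right_mono)
qed

abbreviation "K\<^sub>0 \<equiv> tent_const C Q \<eta> m"

lemma tent_const_nonneg: "0 \<le> K\<^sub>0"
  using m_nonneg eta' by (simp add: tent_const_def)

text \<open>The improvement step is an affine contraction with fixed point \<open>K\<^sub>0\<close>;
  iterating it from any finite bound \<open>K\<close> drives the excess over
  \<open>K\<^sub>0\<close> to 0.\<close>

lemma tent_bound_absorb:
  assumes A: "A \<in> sets borel" and tr: "transfers A" and K: "0 \<le> K" "tent_bound A K"
  shows "tent_bound A K\<^sub>0"
proof -
  have eq: "(1 - \<eta>') * K\<^sub>0 + (m + ln 56) = K\<^sub>0"
    using eta' by (simp add: tent_const_def field_simps)
  have iter: "tent_bound A ((1 - \<eta>') ^ n * K + K\<^sub>0)" for n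
  proof (induction n)
    case 0
    have "ennreal K \<le> ennreal (K + K\<^sub>0)" using tent_const_nonneg by (intro ennreal_leI) simp
    then have "tent_bound A (K + K\<^sub>0)"
      unfolding tent_bound_def
      by (intro allI impI order_trans[OF tent_boundD[OF K(2)] mult_right_mono]) auto
    then show ?case by simp
  next
    case (Suc n)
    have "(1 - \<eta>') * ((1 - \<eta>') ^ n * K + K\<^sub>0) + (m + ln 56) = (1 - \<eta>') ^ Suc n * K + K\<^sub>0"
      using eq by (simp add: algebra_simps)
    then show ?case
      using tent_bound_improve[OF A tr _ Suc] eta' K(1) tent_const_nonneg by simp
  qed
  show ?thesis
    unfolding tent_bound_def
  proof (intro allI impI)
    fix U :: "'a set" assume U: "open U" "bounded U" "U \<noteq> UNIV"
    have "emeasure M U < \<infinity>" using U by (intro emeasure_bounded_finite) auto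
    then obtain u where u: "emeasure M U = ennreal u" "0 \<le> u" by (cases "emeasure M U") auto
    have "(\<lambda>n. (1 - \<eta>') ^ n) \<longlonglongrightarrow> 0" using eta' by (intro LIMSEQ_realpow_zero) auto
    then have "(\<lambda>n. ennreal (((1 - \<eta>') ^ n * K + K\<^sub>0) * u)) \<longlonglongrightarrow> ennreal ((0 * K + K\<^sub>0) * u)"
      by (intro tendsto_ennrealI tendsto_mult tendsto_add tendsto_const)
    moreover have "(\<integral>\<^sup>+x. scale_measure (A \<inter> tent U) x \<partial>M) \<le> ennreal (((1 - \<eta>') ^ n * K
        + K\<^sub>0) * u)" for n
      using iter[of n] U u eta' K(1) tent_const_nonneg by (auto simp: tent_bound_def ennreal_mult)
    ultimately have "(\<integral>\<^sup>+x. scale_measure (A \<inter> tent U) x \<partial>M) \<le> ennreal ((0 * K + K\<^sub>0) * u)"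
      by (intro LIMSEQ_le_const) auto
    then show "(\<integral>\<^sup>+x. scale_measure (A \<inter> tent U) x \<partial>M) \<le> ennreal K\<^sub>0 * emeasure M U"
      using u tent_const_nonneg by (simp add: ennreal_mult)
  qed
qed

text \<open>The a priori bound of a truncated set grows with the truncation, but absorption replaces
  it by \<open>K\<^sub>0\<close>, which does not. Monotone convergence then removes the
  truncation.\<close>

lemma tent_bound_transfers:
  assumes A [measurable]: "A \<in> sets borel" and tr: "transfers A"
  shows "tent_bound A K\<^sub>0"
proof -
  define S where "S n = (UNIV :: 'a set) \<times> {1 / real (Suc n)..real (Suc n)}" for n
  have S [measurable]: "S n \<in> sets borel" for n
    unfolding S_def by (intro borel_closed closed_Times) auto
  have "incseq S"
  proof (rule incseq_SucI)
    fix n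
    have "1 / real (Suc (Suc n)) \<le> 1 / real (Suc n)" by (intro divide_left_mono) auto
    then show "S n \<subseteq> S (Suc n)" by (auto simp: S_def)
  qed
  \<comment> \<open>Absorption needs an a priori bound, which is available once the scales are truncated.\<close>
  have trunc: "tent_bound (A \<inter> S n) K\<^sub>0" for n
  proof (rule tent_bound_absorb)
    show "A \<inter> S n \<in> sets borel" by measurable
    show "transfers (A \<inter> S n)" using tr by (auto simp: transfers_def)
    have "1 * 1 \<le> real (Suc n) * real (Suc n)" by (intro mult_mono) auto
    then show "0 \<le> ln (real (Suc n) / (1 / real (Suc n)))" by (intro ln_ge_zero) simp
    show "tent_bound (A \<inter> S n) (ln (real (Suc n) / (1 / real (Suc n))))"
      unfolding tent_bound_def
    proof (intro allI impI)
      fix U :: "'a set" assume U: "open U" "bounded U" "U \<noteq> UNIV"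
      have "scale_measure (A \<inter> S n \<inter> tent U) x \<le> ennreal (ln (real (Suc n) / (1 / real (Suc n))))
          * indicator U x" for x
      proof (cases "x \<in> U")
        case True
        have "scale_measure (A \<inter> S n \<inter> tent U) x \<le> emeasure log_measure {1 / real (Suc n)..real
            (Suc n)}"
          unfolding scale_measure_def by (intro emeasure_mono) (auto simp: S_def)
        also have "\<dots> = ennreal (ln (real (Suc n) / (1 / real (Suc n))))"
        proof (rule emeasure_log_measure_Icc)
          have "1 / real (Suc n) \<le> 1" "1 \<le> real (Suc n)" by auto
          then show "1 / real (Suc n) \<le> real (Suc n)" by (rule order_trans)
        qed simp
        finally show ?thesis using True by simp
      qed (simp add: scale_measure_outside)
      then have "(\<integral>\<^sup>+x. scale_measure (A \<inter> S n \<inter> tent U) x \<partial>M)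
          \<le> (\<integral>\<^sup>+x. ennreal (ln (real (Suc n) / (1 / real (Suc n)))) * indicator U x \<partial>M)"
        by (intro nn_integral_mono)
      also have "\<dots> = ennreal (ln (real (Suc n) / (1 / real (Suc n)))) * emeasure M U"
        using U by (intro nn_integral_cmult_indicator) (auto simp: sets_M)
      finally show "(\<integral>\<^sup>+x. scale_measure (A \<inter> S n \<inter> tent U) x \<partial>M)
          \<le> ennreal (ln (real (Suc n) / (1 / real (Suc n)))) * emeasure M U" .
    qed
  qed
  show ?thesis
    unfolding tent_bound_def
  proof (intro allI impI)
    fix U :: "'a set" assume U: "open U" "bounded U" "U \<noteq> UNIV"
    have sup: "scale_measure (A \<inter> tent U) x \<le> (SUP n. scale_measure (A \<inter> S n \<inter> tent U) x)" for x
    proof -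
      have "scale_measure (A \<inter> tent U) x \<le> scale_measure (\<Union>n. A \<inter> S n \<inter> tent U) x"
      proof (rule scale_measure_mono)
        fix s :: real assume s: "0 < s" "(x, s) \<in> A \<inter> tent U"
        obtain n1 where n1: "1 / real (Suc n1) < s" using s(1) by (rule nat_approx_posE)
        obtain n2 :: nat where n2: "s < real n2" using reals_Archimedean2 by blast
        have "1 / real (Suc (max n1 n2)) \<le> 1 / real (Suc n1)" by (intro divide_left_mono) auto
        then have "(x, s) \<in> S (max n1 n2)" using n1 n2 by (auto simp: S_def)
        then show "(x, s) \<in> (\<Union>n. A \<inter> S n \<inter> tent U)" using s by blast
      qed measurable
      also have "\<dots> = emeasure log_measure (\<Union>n. Pair x -` (A \<inter> S n \<inter> tent U))"
        by (simp add: scale_measure_def vimage_UN)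
      also have "\<dots> = (SUP n. scale_measure (A \<inter> S n \<inter> tent U) x)"
        unfolding scale_measure_def using \<open>incseq S\<close>
        by (intro SUP_emeasure_incseq[symmetric]) (auto simp: incseq_def)
      finally show ?thesis .
    qed
    have "(\<integral>\<^sup>+x. scale_measure (A \<inter> tent U) x \<partial>M) \<le> (\<integral>\<^sup>+x. (SUP n. scale_measure (A \<inter> S n \<inter> tent
        U) x) \<partial>M)"
      by (intro nn_integral_mono sup)
    also have "\<dots> = (SUP n. \<integral>\<^sup>+x. scale_measure (A \<inter> S n \<inter> tent U) x \<partial>M)"
      using \<open>incseq S\<close>
      by (intro nn_integral_monotone_convergence_SUP)
        (auto simp: incseq_def le_fun_def intro!: scale_measure_mono)
    also have "\<dots> \<le> ennreal K\<^sub>0 * emeasure M U"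
      using trunc U by (intro SUP_least) (simp add: tent_bound_def)
    finally show "(\<integral>\<^sup>+x. scale_measure (A \<inter> tent U) x \<partial>M) \<le> ennreal K\<^sub>0 * emeasure M U" .
  qed
qed

text \<open>If x lies in the ball and s < r, the ball of radius s around x stays in the ball of
  radius 2 r around p. Its tent therefore covers everything that is integrated, at the price of
  \<open>2 ^ Q\<close>.\<close>

lemma carleson_estimate:
  assumes A [measurable]: "A \<in> sets borel" and tr: "transfers A" and p: "p \<in> E" "0 < r"
  shows "(\<integral>\<^sup>+x\<in>ball p r. scale_measure (A \<inter> scales_below r) x \<partial>M)
      \<le> ennreal (K\<^sub>0 * C * 2 ^ Q * r ^ Q)"
proof -
  have "(\<integral>\<^sup>+x\<in>ball p r. scale_measure (A \<inter> scales_below r) x \<partial>M)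
      \<le> (\<integral>\<^sup>+x. scale_measure (A \<inter> tent (ball p (2 * r))) x \<partial>M)"
  proof (intro nn_integral_mono)
    fix x
    show "scale_measure (A \<inter> scales_below r) x * indicator (ball p r) x
        \<le> scale_measure (A \<inter> tent (ball p (2 * r))) x"
    proof (cases "x \<in> ball p r")
      case True
      have "ball x s \<subseteq> ball p (2 * r)" if "s < r" for s
      proof
        fix y assume "y \<in> ball x s"
        then show "y \<in> ball p (2 * r)" using True that dist_triangle[of p y x] by simp
      qed
      then show ?thesis using True by (auto intro!: scale_measure_mono simp: mem_tent)
    qed simp
  qed
  also have "\<dots> \<le> ennreal K\<^sub>0 * emeasure M (ball p (2 * r))"
  proof (rule tent_boundD[OF tent_bound_transfers[OF A tr]])
    show "ball p (2 * r) \<noteq> UNIV" using unbounded by (metis bounded_ball)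
  qed auto
  also have "\<dots> \<le> ennreal K\<^sub>0 * ennreal (C * (2 * r) ^ Q)"
    using p by (intro mult_left_mono ball_upper) auto
  also have "\<dots> = ennreal (K\<^sub>0 * (C * (2 * r) ^ Q))"
    using p C_ge_1 tent_const_nonneg by (intro ennreal_mult[symmetric]) auto
  finally show ?thesis by (simp add: power_mult_distrib mult.assoc)
qed

end

section \<open>Bilateral beta-numbers\<close>

lemma unbounded_heis: "\<not> bounded (UNIV :: 'k::finite heis set)"
proof
  assume "bounded (UNIV :: 'k heis set)"
  then have "bounded (range (coords :: 'k heis \<Rightarrow> _))" by (rule bounded_coords)
  moreover have "range (coords :: 'k heis \<Rightarrow> _) = UNIV" by (metis coords_Heis surjI)
  ultimately show False using not_bounded_UNIV by metis
qed

abbreviation hyperplane :: "((real^'k) \<times> (real^'k)) \<times> real \<Rightarrow> real \<Rightarrow> 'k::finite heis set" where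
  "hyperplane a b \<equiv> {q. a \<bullet> coords q = b}"

lemma hyperplane_unit_normal:
  assumes "P \<in> hyperplanes"
  obtains a b where "norm a = 1" "P = hyperplane a b"
proof -
  obtain a b where ab: "a \<noteq> 0" "P = hyperplane a b" using assms by (auto simp: hyperplanes_def)
  then have "P = hyperplane (a /\<^sub>R norm a) (b / norm a)" by (auto simp: field_simps)
  with ab(1) show thesis by (intro that[of "a /\<^sub>R norm a" "b / norm a"]) auto
qed

lemma hyperplane_mem:
  assumes "norm a = 1"
  shows "hyperplane a b \<in> hyperplanes"
proof -
  have "a \<noteq> 0" using assms by auto
  then show ?thesis unfolding hyperplanes_def by (intro CollectI exI[of _ a] exI[of _ b]) simp
qed

lemma closed_hyperplane_heis: "closed (hyperplane a b)"
  by (intro closed_Collect_eq continuous_intros continuous_on_coords)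

lemma projection_mem_hyperplane:
  assumes "norm a = 1"
  shows "Heis (coords q - (a \<bullet> coords q - b) *\<^sub>R a) \<in> hyperplane a b"
proof -
  have "a \<bullet> a = 1" using assms by (simp add: dot_square_norm)
  then show ?thesis by (simp add: inner_diff_right)
qed

text \<open>Real upper bounds for the two suprema separately. Unlike the extended-valued suprema,
  they can be moved between points and passed to a limit pointwise.\<close>

definition flat_near :: "'k::finite heis set \<Rightarrow> 'k heis set \<Rightarrow> 'k heis \<Rightarrow> real \<Rightarrow> real \<Rightarrow> real \<Rightarrow> bool"
    where
  "flat_near E P x s \<alpha> \<beta> \<longleftrightarrow> (\<forall>q\<in>ball x s \<inter> E. infdist q P \<le> \<alpha>) \<and> (\<forall>q\<in>ball x s \<inter> P. infdist q E \<le> \<beta>)"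

lemma bbeta_leI:
  assumes "P \<in> hyperplanes" "0 < s" "0 \<le> \<alpha>" "0 \<le> \<beta>" "\<alpha> + \<beta> \<le> c * s" "flat_near E P x s \<alpha> \<beta>"
  shows "bbeta E x s \<le> ennreal c"
proof -
  have "bbeta E x s \<le> ennreal (inverse s) * (ennreal \<alpha> + ennreal \<beta>)"
    unfolding bbeta_def using assms(6)
    by (intro mult_left_mono INF_lower2[OF assms(1)] add_mono SUP_least ennreal_leI) (auto simp:
        flat_near_def)
  also have "\<dots> = ennreal (inverse s * (\<alpha> + \<beta>))"
    using assms by (simp add: ennreal_mult ennreal_plus)
  also have "\<dots> \<le> ennreal c"
    using assms by (intro ennreal_leI) (simp add: field_simps)
  finally show ?thesis .
qed

text \<open>The infimum need not be attained, so a hyperplane can be extracted only from a strict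
  inequality; that inequality also makes both suprema finite.\<close>

lemma bbeta_lessE:
  assumes "bbeta E x s < ennreal c" "0 < s"
  obtains P \<alpha> \<beta> where "P \<in> hyperplanes" "0 \<le> \<alpha>" "0 \<le> \<beta>" "\<alpha> + \<beta> \<le> c * s" "flat_near E P x s \<alpha> \<beta>"
proof -
  define g where "g P = (SUP q\<in>ball x s \<inter> E. ennreal (infdist q P))
      + (SUP q\<in>ball x s \<inter> P. ennreal (infdist q E))" for P
  have c: "0 < c" using assms(1) by (metis ennreal_neg not_le not_less_zero)
  have "(INF P\<in>hyperplanes. g P) = ennreal s * bbeta E x s"
    unfolding bbeta_def g_def[symmetric] using assms(2)
    by (simp add: mult.assoc[symmetric] ennreal_mult[symmetric])
  also have "\<dots> < ennreal s * ennreal c"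
    using assms by (intro ennreal_mult_strict_left_mono) auto
  also have "\<dots> = ennreal (c * s)" using assms(2) c by (simp add: ennreal_mult mult.commute)
  finally obtain P where P: "P \<in> hyperplanes" "g P < ennreal (c * s)" by (auto simp: INF_less_iff)
  define A B where "A = (SUP q\<in>ball x s \<inter> E. ennreal (infdist q P))"
    and "B = (SUP q\<in>ball x s \<inter> P. ennreal (infdist q E))"
  have "A + B < top" using P(2) by (metis A_def B_def g_def ennreal_less_top less_trans)
  then obtain \<alpha> \<beta> where ab: "A = ennreal \<alpha>" "B = ennreal \<beta>" "0 \<le> \<alpha>" "0 \<le> \<beta>"
    by (cases A; cases B) auto
  have "ennreal (\<alpha> + \<beta>) < ennreal (c * s)"
    using P(2) ab by (simp add: g_def A_def[symmetric] B_def[symmetric] ennreal_plus)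
  then have "\<alpha> + \<beta> \<le> c * s" using ab by (simp add: ennreal_less_iff del: ennreal_plus)
  moreover have "infdist q P \<le> \<alpha>" if "q \<in> ball x s \<inter> E" for q
  proof -
    have "ennreal (infdist q P) \<le> A" unfolding A_def using that by (rule SUP_upper)
    then show ?thesis using ab by simp
  qed
  moreover have "infdist q E \<le> \<beta>" if "q \<in> ball x s \<inter> P" for q
  proof -
    have "ennreal (infdist q E) \<le> B" unfolding B_def using that by (rule SUP_upper)
    then show ?thesis using ab by simp
  qed
  ultimately show thesis using P(1) ab by (intro that[of P \<alpha> \<beta>]) (auto simp: flat_near_def)
qed

text \<open>For every hyperplane both suprema grow when the ball of radius s is replaced by the
  larger one of radius 2 s; only the normalisation by the radius costs the factor 2.\<close>

lemma bbeta_transfer: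
  assumes "0 < s" "dist q x \<le> s" "ennreal c < bbeta E q s" "0 \<le> c"
  shows "ennreal (c / 2) < bbeta E x (2 * s)"
proof -
  have sub: "ball q s \<subseteq> ball x (2 * s)"
  proof
    fix y assume "y \<in> ball q s"
    then show "y \<in> ball x (2 * s)" using assms(2) dist_triangle[of x y q]
        by (simp add: dist_commute)
  qed
  have "bbeta E q s \<le> ennreal (inverse s) *
     (INF P\<in>hyperplanes. (SUP y\<in>ball x (2 * s) \<inter> E. ennreal (infdist y P))
         + (SUP y\<in>ball x (2 * s) \<inter> P. ennreal (infdist y E)))"
    unfolding bbeta_def using sub
    by (intro mult_left_mono INF_mono' add_mono SUP_subset_mono) auto
  also have "ennreal (inverse s) = 2 * ennreal (inverse (2 * s))"
    using assms(1) by (simp add: ennreal_mult[symmetric] flip: ennreal_numeral)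
  finally have "bbeta E q s \<le> 2 * bbeta E x (2 * s)" by (simp add: bbeta_def mult.assoc)
  then have "ennreal c < 2 * bbeta E x (2 * s)" using assms(3) by (rule less_le_trans[rotated])
  then show ?thesis
    using assms(4)
    by (cases "bbeta E x (2 * s)") (auto simp: ennreal_less_iff ennreal_mult[symmetric] simp flip:
        ennreal_numeral)
qed

text \<open>
  An infimum of lower semicontinuous functions need not be lower semicontinuous; here the relevant
  hyperplanes (unit normals, bounded offsets) form a compact family.
\<close>

lemma bbeta_lower_semicontinuous:
  fixes E :: "'k::finite heis set"
  assumes xE: "\<And>n. x n \<in> E" and x: "x \<longlonglongrightarrow> x0" and s0: "0 < s0" and spos: "\<And>n. 0 < s n" and s: "s \<longlonglongrightarrow> s0"
    and le: "\<And>n. bbeta E (x n) (s n) \<le> ennreal c" and c: "0 \<le> c"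
  shows "bbeta E x0 s0 \<le> ennreal c"
proof -
  \<comment> \<open>Vanishing slack that turns the weak inequality into the strict one needed to
    extract a hyperplane.\<close>
  define c' where "c' n = c + 1 / real (Suc n)" for n
  have "\<exists>a b \<alpha> \<beta>. norm a = 1 \<and> 0 \<le> \<alpha> \<and> 0 \<le> \<beta> \<and> \<alpha> + \<beta> \<le> c' n * s n
      \<and> flat_near E (hyperplane a b) (x n) (s n) \<alpha> \<beta>" for n
  proof -
    have "bbeta E (x n) (s n) < ennreal (c' n)"
      using c by (intro le_less_trans[OF le] ennreal_lessI) (auto simp: c'_def add_nonneg_pos)
    then obtain P \<alpha> \<beta> where P: "P \<in> hyperplanes" "0 \<le> \<alpha>" "0 \<le> \<beta>" "\<alpha> + \<beta>
        \<le> c' n * s n" "flat_near E P (x n) (s n) \<alpha> \<beta>"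
      by (rule bbeta_lessE[OF _ spos])
    obtain a b where "norm a = 1" "P = hyperplane a b" using hyperplane_unit_normal[OF P(1)] .
    then show ?thesis using P by blast
  qed
  then obtain a b \<alpha> \<beta> where
    a: "\<And>n. norm (a n) = 1" and \<alpha>: "\<And>n. 0 \<le> \<alpha> n" and \<beta>: "\<And>n. 0 \<le> \<beta> n"
    and sum: "\<And>n. \<alpha> n + \<beta> n \<le> c' n * s n"
    and flat: "\<And>n. flat_near E (hyperplane (a n) (b n)) (x n) (s n) (\<alpha> n) (\<beta> n)"
    by metis
  define P where "P n = hyperplane (a n) (b n)" for n
  have P_ne: "P n \<noteq> {}" for n unfolding P_def using projection_mem_hyperplane[OF a] by blast
  have P_closed: "closed (P n)" for n unfolding P_def by (rule closed_hyperplane_heis)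
  have c': "c' \<longlonglongrightarrow> c"
    using tendsto_add[OF tendsto_const LIMSEQ_inverse_real_of_nat, of c]
        by (simp add: c'_def[abs_def] inverse_eq_divide)
  have cs: "(\<lambda>n. c' n * s n) \<longlonglongrightarrow> c * s0" using c' s by (rule tendsto_mult)
  then have "Bseq (\<lambda>n. c' n * s n)" by (intro convergent_imp_Bseq convergentI)
  then obtain B where B: "\<And>n. norm (c' n * s n) \<le> B" unfolding Bseq_def by blast
  have \<alpha>B: "\<alpha> n \<le> B" and \<beta>B: "\<beta> n \<le> B" for n
    using B[of n] sum[of n] \<alpha>[of n] \<beta>[of n] by auto
  \<comment> \<open>The centre \<open>x n\<close> is itself a point of \<open>E\<close> in the ball,
    so \<open>P n\<close> passes within \<open>\<alpha> n\<close> of it. This keeps offsets and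
    nearest points bounded and so supplies the compactness.\<close>
  have near: "infdist y (P n) \<le> B + dist y (x n)" for y n
  proof -
    have "infdist (x n) (P n) \<le> \<alpha> n" using flat[of n] xE[of n] spos[of n]
        by (auto simp: flat_near_def P_def)
    then show ?thesis using infdist_triangle[of y "P n" "x n"] \<alpha>B[of n] by linarith
  qed
  have xb: "bounded (range x)" using x by (rule convergent_imp_bounded)
  have pts: "\<exists>z. \<forall>n. z n \<in> P n \<and> dist y (z n) = infdist y (P n)" for y
  proof (rule choice, rule allI)
    fix n
    obtain z where "z \<in> P n" "infdist y (P n) = dist y z"
        using infdist_attains_inf[OF P_closed P_ne] .
    then show "\<exists>z. z \<in> P n \<and> dist y z = infdist y (P n)" by auto
  qed
  have bdd: "bounded (range z)" if "\<And>n. dist y (z n) = infdist y (P n)" for y z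
  proof -
    obtain R where R: "\<And>n. dist y (x n) \<le> R" using xb unfolding bounded_any_center[of "range x" y]
        by auto
    have "dist y (z n) \<le> B + R" for n using near[of y n] R[of n] that[of n] by linarith
    then show ?thesis unfolding bounded_any_center[of "range z" y] by auto
  qed
  have "bounded (range b)"
  proof -
    obtain z where z: "\<And>n. z n \<in> P n" "\<And>n. dist x0 (z n) = infdist x0 (P n)" using pts by metis
    obtain R where R: "\<And>n. norm (coords (z n)) \<le> R"
      using bounded_coords[OF bdd[OF z(2)]] unfolding bounded_iff by auto
    have "norm (b n) \<le> R" for n
    proof -
      have "b n = a n \<bullet> coords (z n)" using z(1)[of n] by (simp add: P_def)
      then have "norm (b n) \<le> norm (a n) * norm (coords (z n))" by (simp add: Cauchy_Schwarz_ineq2)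
      then show ?thesis using a R[of n] by simp
    qed
    then show ?thesis unfolding bounded_iff by auto
  qed
  moreover have "bounded (range a)" unfolding bounded_iff using a by (auto intro!: exI[of _ 1])
  moreover have "bounded (range \<alpha>)" "bounded (range \<beta>)"
    unfolding bounded_iff using \<alpha> \<alpha>B \<beta> \<beta>B by (auto intro!: exI[of _ B])
  ultimately have "bounded ((range a \<times> range b) \<times> (range \<alpha> \<times> range \<beta>))" by (intro bounded_Times)
  then have "bounded (range (\<lambda>n. ((a n, b n), (\<alpha> n, \<beta> n))))" by (rule bounded_subset) auto
  then obtain l r where r: "strict_mono (r :: nat \<Rightarrow> nat)"
      and l: "((\<lambda>n. ((a n, b n), (\<alpha> n, \<beta> n))) \<circ> r) \<longlonglongrightarrow> l"
    using bounded_imp_convergent_subsequence by blast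
  obtain a0 b0 \<alpha>0 \<beta>0 where l_eq: "l = ((a0, b0), (\<alpha>0, \<beta>0))" by (metis prod.exhaust)
  have lim_a: "(\<lambda>n. a (r n)) \<longlonglongrightarrow> a0" using tendsto_fst[OF tendsto_fst[OF l]] by (simp add: l_eq o_def)
  have lim_b: "(\<lambda>n. b (r n)) \<longlonglongrightarrow> b0" using tendsto_snd[OF tendsto_fst[OF l]] by (simp add: l_eq o_def)
  have lim_\<alpha>: "(\<lambda>n. \<alpha> (r n)) \<longlonglongrightarrow> \<alpha>0" using tendsto_fst[OF tendsto_snd[OF l]] by (simp add: l_eq o_def)
  have lim_\<beta>: "(\<lambda>n. \<beta> (r n)) \<longlonglongrightarrow> \<beta>0" using tendsto_snd[OF tendsto_snd[OF l]] by (simp add: l_eq o_def)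
  have lim_x: "(\<lambda>n. x (r n)) \<longlonglongrightarrow> x0" using LIMSEQ_subseq_LIMSEQ[OF x r] by (simp add: o_def)
  have lim_s: "(\<lambda>n. s (r n)) \<longlonglongrightarrow> s0" using LIMSEQ_subseq_LIMSEQ[OF s r] by (simp add: o_def)
  have norm_a0: "norm a0 = 1"
  proof -
    have "(\<lambda>n. 1) \<longlonglongrightarrow> norm a0" using tendsto_norm[OF lim_a] a by simp
    then show ?thesis using LIMSEQ_unique[OF tendsto_const] by metis
  qed
  have in_ball: "\<forall>\<^sub>F n in sequentially. z n \<in> ball (x (r n)) (s (r n))"
      if "z \<longlonglongrightarrow> y" "y \<in> ball x0 s0" for z y
  proof -
    have "(\<lambda>n. s (r n) - dist (x (r n)) (z n)) \<longlonglongrightarrow> s0 - dist x0 y"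
      by (intro tendsto_intros lim_x lim_s that)
    moreover have "0 < s0 - dist x0 y" using that by simp
    ultimately have "\<forall>\<^sub>F n in sequentially. 0 < s (r n) - dist (x (r n)) (z n)"
        by (rule order_tendstoD)
    then show ?thesis by (rule eventually_mono) simp
  qed
  \<comment> \<open>Nearest points to q in the hyperplanes \<open>P n\<close> are bounded; a further
    subsequence converges to a point of the limit hyperplane.\<close>
  have "infdist q (hyperplane a0 b0) \<le> \<alpha>0" if q: "q \<in> ball x0 s0 \<inter> E" for q
  proof -
    obtain z where z: "\<And>n. z n \<in> P n" "\<And>n. dist q (z n) = infdist q (P n)" using pts by metis
    have "bounded (range (\<lambda>n. z (r n)))" using bdd[OF z(2)] by (rule bounded_subset) auto
    then obtain y r' where r': "strict_mono (r' :: nat \<Rightarrow> nat)" and y: "((\<lambda>n. z (r n)) \<circ> r') \<longlonglongrightarrow> y"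
      using bounded_imp_convergent_subsequence by blast
    have y: "(\<lambda>n. z (r (r' n))) \<longlonglongrightarrow> y" using y by (simp add: o_def)
    have "(\<lambda>n. a (r (r' n)) \<bullet> coords (z (r (r' n)))) \<longlonglongrightarrow> a0 \<bullet> coords y"
      using LIMSEQ_subseq_LIMSEQ[OF lim_a r'] by (intro tendsto_inner tendsto_coords y) (simp add:
          o_def)
    moreover have "(\<lambda>n. b (r (r' n))) \<longlonglongrightarrow> b0" using LIMSEQ_subseq_LIMSEQ[OF lim_b r']
        by (simp add: o_def)
    moreover have "a (r (r' n)) \<bullet> coords (z (r (r' n))) = b (r (r' n))" for n
      using z(1)[of "r (r' n)"] by (simp add: P_def)
    ultimately have "a0 \<bullet> coords y = b0" using LIMSEQ_unique by simp
    then have "infdist q (hyperplane a0 b0) \<le> dist q y" by (intro infdist_le) simp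
    also have "\<dots> \<le> \<alpha>0"
    proof (rule tendsto_le[OF sequentially_bot])
      show "(\<lambda>n. \<alpha> (r (r' n))) \<longlonglongrightarrow> \<alpha>0" using LIMSEQ_subseq_LIMSEQ[OF lim_\<alpha> r'] by (simp add: o_def)
      show "(\<lambda>n. dist q (z (r (r' n)))) \<longlonglongrightarrow> dist q y" by (intro tendsto_intros y)
      have "\<forall>\<^sub>F n in sequentially. q \<in> ball (x (r n)) (s (r n))"
        using q by (intro in_ball[OF tendsto_const]) simp
      then have "\<forall>\<^sub>F n in sequentially. q \<in> ball (x (r (r' n))) (s (r (r' n)))"
        using eventually_subseq[OF r'] by blast
      then show "\<forall>\<^sub>F n in sequentially. dist q (z (r (r' n))) \<le> \<alpha> (r (r' n))"
      proof eventually_elim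
        case (elim n)
        then show ?case using flat[of "r (r' n)"] q z(2)[of "r (r' n)"]
            by (auto simp: flat_near_def P_def)
      qed
    qed
    finally show ?thesis .
  qed
  moreover have "infdist q E \<le> \<beta>0" if q: "q \<in> ball x0 s0 \<inter> hyperplane a0 b0" for q
  proof -
    \<comment> \<open>Euclidean projections of q. They need not be nearest points for the Koranyi
      distance, but it is enough that they lie on the hyperplanes and converge to q.\<close>
    define z where "z n = Heis (coords q - (a (r n) \<bullet> coords q - b (r n)) *\<^sub>R a (r n))" for n
    have zP: "z n \<in> P (r n)" for n unfolding z_def P_def by (rule projection_mem_hyperplane[OF a])
    have "z \<longlonglongrightarrow> Heis (coords q - (a0 \<bullet> coords q - b0) *\<^sub>R a0)"
      unfolding z_def[abs_def] by (intro tendsto_Heis tendsto_intros lim_a lim_b)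
    then have z: "z \<longlonglongrightarrow> q" using q by simp
    show ?thesis
    proof (rule tendsto_le[OF sequentially_bot lim_\<beta>])
      show "(\<lambda>n. infdist (z n) E) \<longlonglongrightarrow> infdist q E" by (intro tendsto_infdist z)
      show "\<forall>\<^sub>F n in sequentially. infdist (z n) E \<le> \<beta> (r n)"
        using in_ball[OF z] q
      proof (simp, elim eventually_mono)
        fix n assume "dist (x (r n)) (z n) < s (r n)"
        then show "infdist (z n) E \<le> \<beta> (r n)" using flat[of "r n"] zP[of n]
            by (auto simp: flat_near_def P_def)
      qed
    qed
  qed
  moreover have "0 \<le> \<alpha>0" "0 \<le> \<beta>0"
    using LIMSEQ_le_const[OF lim_\<alpha>] LIMSEQ_le_const[OF lim_\<beta>] \<alpha> \<beta> by auto
  moreover have "\<alpha>0 + \<beta>0 \<le> c * s0"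
  proof (rule LIMSEQ_le)
    show "(\<lambda>n. \<alpha> (r n) + \<beta> (r n)) \<longlonglongrightarrow> \<alpha>0 + \<beta>0" by (intro tendsto_add lim_\<alpha> lim_\<beta>)
    show "(\<lambda>n. c' (r n) * s (r n)) \<longlonglongrightarrow> c * s0" using LIMSEQ_subseq_LIMSEQ[OF cs r]
        by (simp add: o_def)
  qed (use sum in auto)
  ultimately show ?thesis
    using s0 by (intro bbeta_leI[OF hyperplane_mem[OF norm_a0, of b0]]) (auto simp: flat_near_def)
qed

definition bad_set :: "real \<Rightarrow> 'k::finite heis set \<Rightarrow> ('k heis \<times> real) set" where
  "bad_set \<epsilon> E = {(p, s). p \<in> E \<and> s > 0 \<and> bbeta E p s > ennreal \<epsilon>}"

text \<open>Lower semicontinuity makes the set of remaining pairs relatively closed. The open set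
  \<open>W\<close> serves both measurability and the closedness of the sets of good points.\<close>

lemma bad_set_relatively_open:
  assumes "0 \<le> \<epsilon>"
  obtains W where "open W" "bad_set \<epsilon> E = W \<inter> E \<times> {0<..}"
proof -
  define Z where "Z = E \<times> {0<..} - bad_set \<epsilon> E"
  have "z \<in> Z" if z: "z \<in> closure Z" "z \<in> E \<times> {0<..}" for z
  proof -
    obtain f where f: "\<And>n. f n \<in> Z" "f \<longlonglongrightarrow> z" using z(1) unfolding closure_sequential by blast
    have "bbeta E (fst z) (snd z) \<le> ennreal \<epsilon>"
    proof (rule bbeta_lower_semicontinuous[OF _ _ _ _ _ _ assms])
      show "fst (f n) \<in> E" "0 < snd (f n)" "bbeta E (fst (f n)) (snd (f n)) \<le> ennreal \<epsilon>" for n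
        using f(1)[of n] by (auto simp: Z_def bad_set_def)
      show "(\<lambda>n. fst (f n)) \<longlonglongrightarrow> fst z" "(\<lambda>n. snd (f n)) \<longlonglongrightarrow> snd z"
        using f(2) by (auto intro: tendsto_fst tendsto_snd)
      show "0 < snd z" using that(2) by auto
    qed
    then show ?thesis using that(2) by (auto simp: Z_def bad_set_def)
  qed
  moreover have "Z \<subseteq> closure Z" by (rule closure_subset)
  moreover have "bad_set \<epsilon> E \<subseteq> E \<times> {0<..}" by (auto simp: bad_set_def)
  ultimately have "bad_set \<epsilon> E = - closure Z \<inter> E \<times> {0<..}" unfolding Z_def by blast
  then show thesis by (intro that[of "- closure Z"]) auto
qed

lemma bad_set_borel:
  assumes "0 \<le> \<epsilon>" "closed E"
  shows "bad_set \<epsilon> E \<in> sets borel"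
proof -
  obtain W where W: "open W" "bad_set \<epsilon> E = W \<inter> E \<times> {0<..}"
      using bad_set_relatively_open[OF assms(1)] .
  have "E \<times> {0<..} = (E \<times> UNIV) \<inter> (UNIV \<times> {0 :: real<..})" by auto
  moreover have "closed (E \<times> (UNIV :: real set))" "open (UNIV \<times> {0 :: real<..} :: ('a heis \<times> real)
      set)"
    by (intro closed_Times open_Times assms; simp)+
  ultimately show ?thesis unfolding W(2) using W(1) by auto
qed

text \<open>Points are moved between the two sets at a cost of c s each. At scale 2 s the errors of
  \<open>E'\<close> add up to at most 4 c s, so the total is at most 6 c s; with c at most 1 / 10 no
  moved point leaves the ball of radius 2 s.\<close>

lemma bbeta_comparison:
  assumes closed: "closed E'" and x: "x \<in> E'" and s: "0 < s" and c: "0 < c" "c \<le> 1 / 10"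
    and near: "\<And>y. y \<in> E \<Longrightarrow> dist x y < 2 * s \<Longrightarrow> infdist y E' \<le> c * s"
      "\<And>y. y \<in> E' \<Longrightarrow> dist x y < 2 * s \<Longrightarrow> infdist y E \<le> c * s"
    and le: "bbeta E' x (2 * s) \<le> ennreal c"
  shows "bbeta E x s \<le> ennreal (10 * c)"
proof -
  have ne: "E' \<noteq> {}" using x by auto
  have "bbeta E' x (2 * s) < ennreal (2 * c)" using c
      by (intro le_less_trans[OF le] ennreal_lessI) auto
  then obtain P \<alpha> \<beta> where P: "P \<in> hyperplanes" "0 \<le> \<alpha>" "0 \<le> \<beta>" "\<alpha> + \<beta>
      \<le> 2 * c * (2 * s)" "flat_near E' P x (2 * s) \<alpha> \<beta>"
    using s by (elim bbeta_lessE) auto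
  have cs: "c * s \<le> s / 10" "0 < c * s" using c s by auto
  show ?thesis
  proof (rule bbeta_leI[OF P(1) s])
    show "0 \<le> \<alpha> + c * s" "0 \<le> \<beta> + c * s" using P cs by auto
    show "\<alpha> + c * s + (\<beta> + c * s) \<le> 10 * c * s" using P(4) cs by simp
    show "flat_near E P x s (\<alpha> + c * s) (\<beta> + c * s)"
      unfolding flat_near_def
    proof safe
      fix q assume q: "q \<in> ball x s" "q \<in> E"
      obtain q' where q': "q' \<in> E'" "infdist q E' = dist q q'"
          using infdist_attains_inf[OF closed ne] .
      have "dist q q' \<le> c * s" using near(1)[of q] q q' s by simp
      then have "dist x q' < 2 * s" using q cs(1) dist_triangle[of x q' q] s unfolding mem_ball
          by linarith
      then have "q' \<in> ball x (2 * s)" by simp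
      then have "infdist q' P \<le> \<alpha>" using P(5) q' by (auto simp: flat_near_def)
      then show "infdist q P \<le> \<alpha> + c * s" using infdist_triangle[of q P q'] \<open>dist q q' \<le> c * s\<close>
          by linarith
    next
      fix q assume q: "q \<in> ball x s" "q \<in> P"
      obtain q' where q': "q' \<in> E'" "infdist q E' = dist q q'"
          using infdist_attains_inf[OF closed ne] .
      have "q \<in> ball x (2 * s) \<inter> P" using q s by simp
      then have "dist q q' \<le> \<beta>" using P(5) q'(2) unfolding flat_near_def by metis
      moreover have "\<alpha> + \<beta> \<le> 4 * (c * s)" using P(4) by simp
      then have "\<beta> < s" using cs(1) P(2) s by linarith
      ultimately have "dist x q' < 2 * s" using q dist_triangle[of x q' q] by simp
      then have "infdist q' E \<le> c * s" using near(2) q' by blast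
      then show "infdist q E \<le> \<beta> + c * s" using infdist_triangle[of q E q'] \<open>dist q q' \<le> \<beta>\<close>
          by linarith
    qed
  qed
qed

section \<open>Big pieces\<close>

definition surface :: "'k::finite heis set \<Rightarrow> 'k heis measure" where
  "surface E = density (hausdorff_measure (hdim TYPE('k))) (indicator E)"

lemma sets_surface [simp, measurable_cong]: "sets (surface E) = sets borel"
  by (simp add: surface_def)

lemma nn_integral_surface:
  fixes E :: "'k::finite heis set"
  assumes [measurable]: "E \<in> sets borel" "f \<in> borel_measurable borel"
  shows "(\<integral>\<^sup>+x. f x \<partial>surface E) = (\<integral>\<^sup>+x\<in>E. f x \<partial>hausdorff_measure (hdim TYPE('k)))"
  unfolding surface_def by (subst nn_integral_density) (auto simp: mult.commute)

lemma emeasure_surface: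
  fixes E :: "'k::finite heis set"
  assumes [measurable]: "E \<in> sets borel" "A \<in> sets borel"
  shows "emeasure (surface E) A = emeasure (hausdorff_measure (hdim TYPE('k))) (E \<inter> A)"
  unfolding surface_def
  by (subst emeasure_density) (auto simp: indicator_inter_arith[symmetric] nn_integral_indicator)

lemma ahlfors_measure_surface:
  fixes E :: "'k::finite heis set"
  assumes C: "1 \<le> C" and E: "ahlfors_regular C E"
  shows "ahlfors_measure (surface E) E C (hdim TYPE('k))"
proof
  have cl: "closed E" using E by (simp add: ahlfors_regular_def)
  then have Eb [measurable]: "E \<in> sets borel" by (rule borel_closed)
  show "sets (surface E) = sets borel" "closed E" "1 \<le> C" by (simp_all add: cl C)
  show "AE x in surface E. x \<in> E"
    unfolding surface_def by (subst AE_density) (auto simp: indicator_def)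
  fix p and r :: real assume "p \<in> E" "0 < r"
  then show "ennreal (r ^ hdim TYPE('k) / C) \<le> emeasure (surface E) (ball p r)"
    and "emeasure (surface E) (ball p r) \<le> ennreal (C * r ^ hdim TYPE('k))"
    using E Eb by (auto simp: ahlfors_regular_def emeasure_surface divide_inverse mult.commute)
qed

lemma carleson_integral_surface:
  fixes E :: "'k::finite heis set"
  assumes C: "1 \<le> C" and E: "ahlfors_regular C E" and A [measurable]: "A \<in> sets borel"
  shows "(\<integral>\<^sup>+s\<in>{0<..<r}. ((\<integral>\<^sup>+q\<in>E \<inter> ball p r. indicator A (q, s) \<partial>hausdorff_measure (hdim
      TYPE('k))) * ennreal (1 / s)) \<partial>lborel)
    = (\<integral>\<^sup>+x\<in>ball p r. scale_measure (A \<inter> scales_below r) x \<partial>surface E)"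
proof -
  interpret ahlfors_measure "surface E" E C "hdim TYPE('k)"
      by (rule ahlfors_measure_surface[OF C E])
  have AP [measurable]: "A \<in> sets (borel \<Otimes>\<^sub>M borel)" unfolding borel_prod by (rule A)
  have [measurable]: "ball p r \<in> sets borel" by simp
  have [measurable]: "(\<lambda>s. (\<integral>\<^sup>+x. indicator A (x, s) * indicator (ball p r) x \<partial>surface E)) \<in>
      borel_measurable borel"
    by measurable
  have "(\<integral>\<^sup>+q\<in>E \<inter> ball p r. indicator A (q, s) \<partial>hausdorff_measure (hdim TYPE('k)))
      = (\<integral>\<^sup>+x. indicator A (x, s) * indicator (ball p r) x \<partial>surface E)" for s
    by (subst nn_integral_surface) (auto intro!: nn_integral_cong simp: indicator_def)
  then have "(\<integral>\<^sup>+s\<in>{0<..<r}. ((\<integral>\<^sup>+q\<in>E \<inter> ball p r. indicator A (q, s) \<partial>hausdorff_measure (hdim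
      TYPE('k))) * ennreal (1 / s)) \<partial>lborel)
    = (\<integral>\<^sup>+s\<in>{0<..}. ((\<integral>\<^sup>+x. indicator A (x, s) * indicator (ball p r) x \<partial>surface E) * indicator
        {..<r} s) * ennreal (1 / s) \<partial>lborel)"
    by (intro nn_integral_cong) (auto simp: indicator_def)
  also have "\<dots> = (\<integral>\<^sup>+s. (\<integral>\<^sup>+x. indicator A (x, s) * indicator (ball p r) x \<partial>surface E) * indicator
      {..<r} s \<partial>log_measure)"
    by (rule nn_integral_log_measure[symmetric]) measurable
  also have "\<dots> = (\<integral>\<^sup>+x\<in>ball p r. scale_measure (A \<inter> scales_below r) x \<partial>surface E)"
    by (rule scale_measure_Fubini[OF A])
  finally show ?thesis .
qed

text \<open>The measurability demanded of Carleson sets holds automatically for bad sets of closed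
  sets, and Fubini rewrites the Carleson integral as an integral over points.\<close>

lemma BWGL_iff:
  fixes E :: "'k::finite heis set"
  assumes C: "1 \<le> C"
  shows "E \<in> BWGL C \<gamma> \<longleftrightarrow> ahlfors_regular C E \<and> (\<forall>\<epsilon>\<in>{0<..<1}. \<forall>p\<in>E. \<forall>r>0.
    (\<integral>\<^sup>+x\<in>ball p r. scale_measure (bad_set \<epsilon> E \<inter> scales_below r) x \<partial>surface E)
        \<le> ennreal (\<gamma> \<epsilon> * r ^ hdim TYPE('k)))"
proof (cases "ahlfors_regular C E")
  case True
  then have cl: "closed E" by (simp add: ahlfors_regular_def)
  have "bad_set \<epsilon> E \<subseteq> E \<times> {0<..}" for \<epsilon> by (auto simp: bad_set_def)
  then have "carleson_set E (\<gamma> \<epsilon>) (bad_set \<epsilon> E) \<longleftrightarrow> (\<forall>p\<in>E. \<forall>r>0.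
    (\<integral>\<^sup>+x\<in>ball p r. scale_measure (bad_set \<epsilon> E \<inter> scales_below r) x \<partial>surface E)
        \<le> ennreal (\<gamma> \<epsilon> * r ^ hdim TYPE('k)))"
    if "\<epsilon> \<in> {0<..<1}" for \<epsilon>
    using that bad_set_borel[OF _ cl, of \<epsilon>]
    by (simp add: carleson_set_def carleson_integral_surface[OF C True])
  then show ?thesis using True by (simp add: BWGL_def flip: bad_set_def)
qed (simp add: BWGL_def)

text \<open>Both surface measures restrict the same Hausdorff measure, so they agree on the common
  part \<open>D\<close>; this is how estimates on \<open>E'\<close> reach \<open>E\<close>.\<close>

lemma surface_integral_le:
  fixes E E' :: "'k::finite heis set"
  assumes [measurable]: "E \<in> sets borel" "E' \<in> sets borel" "f \<in> borel_measurable borel" "g \<in>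
      borel_measurable borel"
    "D \<in> sets borel" "D' \<in> sets borel"
    and "D \<subseteq> E" "D \<subseteq> E' \<inter> D'" "\<And>x. x \<in> D \<Longrightarrow> f x \<le> g x"
  shows "(\<integral>\<^sup>+x\<in>D. f x \<partial>surface E) \<le> (\<integral>\<^sup>+x\<in>D'. g x \<partial>surface E')"
  using assms(7-9)
  by (subst (1 2) nn_integral_surface) (auto intro!: nn_integral_mono simp: indicator_def split:
      if_splits)

text \<open>Gaps of \<open>E\<close> away from \<open>E'\<close>, gaps of \<open>E'\<close> away
  from \<open>E\<close>, and bad scales of \<open>E'\<close>. The last two are estimated on a ball
  of doubled radius, whence \<open>2 ^ Q\<close>.\<close>

definition big_piece_const :: "real \<Rightarrow> real \<Rightarrow> nat \<Rightarrow> real \<Rightarrow> real \<Rightarrow> real" where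
  "big_piece_const C C\<^sub>1 Q c g = gap_const C Q c + 2 ^ Q * gap_const C\<^sub>1 Q c + 2 ^ Q * g"

text \<open>The centre p need not belong to \<open>E'\<close>. Estimates on \<open>E'\<close> are
  therefore centred at a common point \<open>p'\<close> with radius 2 r, which also leaves room for
  scales 2 s with s < r.\<close>

lemma big_piece_estimate:
  fixes E E' :: "'k::finite heis set"
  defines "Q \<equiv> hdim TYPE('k)"
  assumes C: "1 \<le> C" and E: "ahlfors_regular C E" and C1: "1 \<le> C\<^sub>1" and E': "E' \<in> BWGL C\<^sub>1 \<gamma>\<^sub>1"
    and c: "0 < c" "c \<le> 1 / 10" "0 \<le> \<gamma>\<^sub>1 c" and p: "p \<in> E" and r: "0 < r"
    and W: "W \<in> sets borel" "bad_set (10 * c) E = W \<inter> E \<times> {0<..}"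
  shows "(\<integral>\<^sup>+x\<in>E \<inter> E' \<inter> ball p r. scale_measure (W \<inter> scales_below r) x \<partial>surface E)
    \<le> ennreal (big_piece_const C C\<^sub>1 Q c (\<gamma>\<^sub>1 c) * r ^ Q)"
proof (cases "E \<inter> E' \<inter> ball p r = {}")
  case True
  then show ?thesis by simp
next
  case False
  then obtain p' where p': "p' \<in> E" "p' \<in> E'" "p' \<in> ball p r" by blast
  have reg': "ahlfors_regular C\<^sub>1 E'" using E' by (simp add: BWGL_def)
  have cl: "closed E" "closed E'" using E reg' by (simp_all add: ahlfors_regular_def)
  interpret M: ahlfors_measure "surface E" E C Q
    unfolding Q_def by (rule ahlfors_measure_surface[OF C E])
  interpret M': ahlfors_measure "surface E'" E' C\<^sub>1 Q
    unfolding Q_def by (rule ahlfors_measure_surface[OF C1 reg'])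
  have sub: "ball p r \<subseteq> ball p' (2 * r)"
  proof
    fix y assume "y \<in> ball p r"
    then show "y \<in> ball p' (2 * r)" using p'(3) dist_triangle[of p' y p] by (simp add: dist_commute)
  qed
  have [measurable]: "W \<in> sets borel" "bad_set c E' \<in> sets borel" "ball y t \<in> sets borel"
      for y :: "'k heis" and t
    using W(1) bad_set_borel[OF _ cl(2), of c] c by auto
  have [measurable]: "scale_measure A \<in> borel_measurable borel" if "A \<in> sets borel"
      for A :: "('k heis \<times> real) set"
    using M.scale_measure_measurable[OF that] by (simp add: measurable_cong_sets[OF sets_surface
        refl])
  let ?G = "E \<inter> E' \<inter> ball p r"
  define f1 f2 f3 where "f1 = scale_measure (gap_set c E E' \<inter> scales_below r)"
    and "f2 = scale_measure (gap_set c E' E \<inter> scales_below (2 * r))"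
    and "f3 = scale_measure (bad_set c E' \<inter> scales_below (2 * r))"
  have [measurable]: "f1 \<in> borel_measurable borel" "f2 \<in> borel_measurable borel" "f3 \<in>
      borel_measurable borel"
    unfolding f1_def f2_def f3_def by measurable
  have split: "scale_measure (W \<inter> scales_below r) x \<le> f1 x + (f2 x + f3 x)" if x: "x \<in> ?G" for x
  proof -
    define B where "B = Pair x -` (bad_set c E' \<inter> scales_below (2 * r))"
    have B [measurable]: "B \<in> sets borel" unfolding B_def by (intro Pair_vimage_borel) measurable
    have B2 [measurable]: "(*) 2 -` B \<in> sets borel"
      by (rule measurable_sets_borel[of _ borel]) (use B in auto)
    have [measurable]: "Pair x -` (gap_set c E E' \<inter> scales_below r) \<in> sets borel"
      "Pair x -` (gap_set c E' E \<inter> scales_below (2 * r)) \<in> sets borel"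
      by (intro Pair_vimage_borel; measurable)+
    \<comment> \<open>Without gaps at scale s on either side, and with 2 s not bad for
      \<open>E'\<close> at threshold c, the comparison makes s not bad for \<open>E\<close> at
      threshold 10 c.\<close>
    have cover: "s \<in> Pair x -` (gap_set c E E' \<inter> scales_below r) \<union>
        (Pair x -` (gap_set c E' E \<inter> scales_below (2 * r)) \<union> (*) 2 -` B)"
      if s: "0 < s" "s < r" "(x, s) \<in> W" for s
    proof (rule ccontr)
      assume neg: "\<not> ?thesis"
      have "bbeta E' x (2 * s) \<le> ennreal c"
        using neg s x by (auto simp: B_def bad_set_def not_less)
      moreover have "infdist y E' \<le> c * s" if "y \<in> E" "dist x y < 2 * s" for y
        using neg s that by (auto simp: gap_set_def not_less)
      moreover have "infdist y E \<le> c * s" if "y \<in> E'" "dist x y < 2 * s" for y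
        using neg s that by (auto simp: gap_set_def not_less)
      ultimately have "bbeta E x s \<le> ennreal (10 * c)"
        using x by (intro bbeta_comparison[OF cl(2) _ s(1) c(1,2)]) auto
      moreover have "(x, s) \<in> bad_set (10 * c) E" unfolding W(2) using s x by auto
      ultimately show False by (simp add: bad_set_def not_less[symmetric])
    qed
    from AE_log_measure_pos have "scale_measure (W \<inter> scales_below r) x
        \<le> emeasure log_measure (Pair x -` (gap_set c E E' \<inter> scales_below r) \<union>
        (Pair x -` (gap_set c E' E \<inter> scales_below (2 * r)) \<union> (*) 2 -` B))"
      unfolding scale_measure_def
      by (intro emeasure_mono_AE) (auto elim!: eventually_mono dest: cover)
    also have "\<dots> \<le> f1 x + (f2 x + emeasure log_measure ((*) 2 -` B))"
      unfolding f1_def f2_def scale_measure_def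
      by (intro order_trans[OF emeasure_subadditive] add_left_mono) auto
    also have "emeasure log_measure ((*) 2 -` B) = f3 x"
      unfolding emeasure_log_measure_scale[OF zero_less_numeral B]
          by (simp add: B_def f3_def scale_measure_def)
    finally show ?thesis .
  qed
  have "(\<integral>\<^sup>+x\<in>?G. scale_measure (W \<inter> scales_below r) x \<partial>surface E) \<le> (\<integral>\<^sup>+x\<in>?G. f1 x + (f2 x
      + f3 x) \<partial>surface E)"
    by (intro nn_integral_mono) (auto simp: indicator_def intro: split)
  also have "\<dots> = (\<integral>\<^sup>+x\<in>?G. f1 x \<partial>surface E) + ((\<integral>\<^sup>+x\<in>?G. f2 x \<partial>surface E)
      + (\<integral>\<^sup>+x\<in>?G. f3 x \<partial>surface E))"
    unfolding distrib_right by (simp add: nn_integral_add)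
  also have "(\<integral>\<^sup>+x\<in>?G. f1 x \<partial>surface E) \<le> (\<integral>\<^sup>+x\<in>E' \<inter> ball p r. f1 x \<partial>surface E)"
    by (intro surface_integral_le) auto
  also have "\<dots> \<le> ennreal (gap_const C Q c * r ^ Q)"
    unfolding f1_def using c p r by (intro M.gap_estimate) auto
  also have "(\<integral>\<^sup>+x\<in>?G. f2 x \<partial>surface E) \<le> (\<integral>\<^sup>+x\<in>E \<inter> ball p' (2 * r). f2 x \<partial>surface E')"
    using sub by (intro surface_integral_le) auto
  also have "\<dots> \<le> ennreal (gap_const C\<^sub>1 Q c * (2 * r) ^ Q)"
    unfolding f2_def using c p' r by (intro M'.gap_estimate) auto
  also have "(\<integral>\<^sup>+x\<in>?G. f3 x \<partial>surface E) \<le> (\<integral>\<^sup>+x\<in>ball p' (2 * r). f3 x \<partial>surface E')"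
    using sub by (intro surface_integral_le) auto
  also have "\<dots> \<le> ennreal (\<gamma>\<^sub>1 c * (2 * r) ^ Q)"
    unfolding f3_def Q_def
    using conjunct2[OF BWGL_iff[OF C1, THEN iffD1, OF E'], rule_format, of c p' "2 * r"] c p' r
        by simp
  also have "ennreal (gap_const C Q c * r ^ Q) + (ennreal (gap_const C\<^sub>1 Q c * (2 * r) ^ Q)
      + ennreal (\<gamma>\<^sub>1 c * (2 * r) ^ Q))
     = ennreal (gap_const C Q c * r ^ Q + (gap_const C\<^sub>1 Q c * (2 * r) ^ Q + \<gamma>\<^sub>1 c * (2 * r) ^ Q))"
    using c C C1 r gap_const_nonneg[of C c Q] gap_const_nonneg[of C\<^sub>1 c Q]
        by (simp add: ennreal_plus)
  also have "gap_const C Q c * r ^ Q + (gap_const C\<^sub>1 Q c * (2 * r) ^ Q + \<gamma>\<^sub>1 c * (2 * r) ^ Q)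
     = big_piece_const C C\<^sub>1 Q c (\<gamma>\<^sub>1 c) * r ^ Q"
    by (simp add: big_piece_const_def power_mult_distrib algebra_simps)
  finally show ?thesis by (simp add: add_mono)
qed

theorem theorem4p6:
  fixes C \<theta> C\<^sub>1 :: real and \<gamma>\<^sub>1 :: "real \<Rightarrow> real"
  assumes "C \<ge> 1" and "\<theta> > 0" and "C\<^sub>1 \<ge> 1" and "\<forall>\<epsilon>\<in>{0<..<1}. \<gamma>\<^sub>1 \<epsilon> > 0"
  shows "\<exists>\<gamma> :: real \<Rightarrow> real. (\<forall>\<epsilon>\<in>{0<..<1}. \<gamma> \<epsilon> > 0) \<and>
    (\<forall>E :: 'k::finite heis set.
       ahlfors_regular C E \<longrightarrow>
       (\<forall>p\<in>E. \<forall>r>0. \<exists>E'\<in>BWGL C\<^sub>1 \<gamma>\<^sub>1.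
          emeasure (hausdorff_measure (hdim TYPE('k))) (E \<inter> E' \<inter> ball p r)
            \<ge> ennreal (\<theta> * r ^ hdim TYPE('k))) \<longrightarrow>
       E \<in> BWGL C \<gamma>)"
proof -
  let ?Q = "hdim TYPE('k)"
  \<comment> \<open>All constants are fixed before \<open>E\<close> appears, which gives the
    required uniformity. The 20 combines the loss 2 of the transfer to a nearby point with the loss
    10 of the comparison.\<close>
  define T where "T \<epsilon> = big_piece_const C C\<^sub>1 ?Q (\<epsilon> / 20) (\<gamma>\<^sub>1 (\<epsilon> / 20))" for \<epsilon>
  \<comment> \<open>Chosen so that Chebyshev's inequality discards at most half of the guaranteed
    measure \<theta> r ^ Q.\<close>
  define m where "m \<epsilon> = 2 * T \<epsilon> / \<theta>" for \<epsilon>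
  define \<eta> where "\<eta> = min 1 (\<theta> / 2)"
  define \<gamma> where "\<gamma> \<epsilon> = tent_const C ?Q \<eta> (m \<epsilon>) * C * 2 ^ ?Q" for \<epsilon>
  have \<eta>: "0 < \<eta>" "\<eta> \<le> 1" "\<eta> \<le> \<theta> / 2" using assms(2) by (auto simp: \<eta>_def)
  have g1: "0 < \<gamma>\<^sub>1 (\<epsilon> / 20)" if "\<epsilon> \<in> {0<..<1}" for \<epsilon> using assms(4) that by auto
  have T: "0 < T \<epsilon>" if "\<epsilon> \<in> {0<..<1}" for \<epsilon>
    using that assms(1,3) g1[OF that] gap_const_nonneg[of C "\<epsilon> / 20" ?Q] gap_const_nonneg[of C\<^sub>1
        "\<epsilon> / 20" ?Q]
    unfolding T_def big_piece_const_def by (intro add_nonneg_pos add_nonneg_nonneg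
        mult_nonneg_nonneg mult_pos_pos) auto
  have m: "0 < m \<epsilon>" if "\<epsilon> \<in> {0<..<1}" for \<epsilon> using T[OF that] assms(2) by (simp add: m_def)
  have "0 < \<gamma> \<epsilon>" if "\<epsilon> \<in> {0<..<1}" for \<epsilon>
    using m[OF that] assms(1) \<eta>(1) unfolding \<gamma>_def tent_const_def good_fraction_def
    by (intro mult_pos_pos divide_pos_pos add_pos_nonneg) auto
  moreover have "E \<in> BWGL C \<gamma>"
    if E: "ahlfors_regular C E" and pieces: "\<forall>p\<in>E. \<forall>r>0. \<exists>E'\<in>BWGL C\<^sub>1 \<gamma>\<^sub>1.
      emeasure (hausdorff_measure ?Q) (E \<inter> E' \<inter> ball p r) \<ge> ennreal (\<theta> * r ^ ?Q)" for E :: "'k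
          heis set"
  proof -
    have cl: "closed E" using E by (simp add: ahlfors_regular_def)
    then have Eb: "E \<in> sets borel" by (rule borel_closed)
    interpret M: ahlfors_measure "surface E" E C ?Q by (rule ahlfors_measure_surface[OF assms(1) E])
    have "(\<integral>\<^sup>+x\<in>ball p r. scale_measure (bad_set \<epsilon> E \<inter> scales_below r) x \<partial>surface E)
        \<le> ennreal (\<gamma> \<epsilon> * r ^ ?Q)"
      if \<epsilon>: "\<epsilon> \<in> {0<..<1}" and pr: "p \<in> E" "0 < r" for \<epsilon> p r
    proof -
      have "0 \<le> \<epsilon> / 2" using \<epsilon> by simp
      then obtain W where W: "open W" "bad_set (\<epsilon> / 2) E = W \<inter> E \<times> {0<..}"
          by (rule bad_set_relatively_open)
      interpret G: big_good_parts "surface E" E C ?Q W \<eta> "m \<epsilon>"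
      proof
        show "\<not> bounded (UNIV :: 'k heis set)" by (rule unbounded_heis)
        show "open W" "0 < \<eta>" "\<eta> \<le> 1" "0 \<le> m \<epsilon>" using W \<eta> m[OF \<epsilon>] by auto
      next
        fix p and r :: real assume p: "p \<in> E" "0 < r"
        obtain E' where E': "E' \<in> BWGL C\<^sub>1 \<gamma>\<^sub>1"
            "ennreal (\<theta> * r ^ ?Q) \<le> emeasure (hausdorff_measure ?Q) (E \<inter> E' \<inter> ball p r)"
          using pieces p by blast
        have "closed E'" using E'(1) by (simp add: BWGL_def ahlfors_regular_def)
        define G where "G = E \<inter> E' \<inter> ball p r"
        have G [measurable]: "G \<in> sets borel" unfolding G_def using cl \<open>closed E'\<close> by auto
        define f where "f = scale_measure (W \<inter> scales_below r)"
        have [measurable]: "W \<in> sets borel" using W(1) by auto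
        have f [measurable]: "f \<in> borel_measurable (surface E)" unfolding f_def by measurable
        have "(\<integral>\<^sup>+x\<in>G. f x \<partial>surface E) \<le> ennreal (T \<epsilon> * r ^ ?Q)"
          unfolding f_def G_def T_def
          using W \<epsilon> p g1[OF \<epsilon>] by (intro big_piece_estimate[OF assms(1) E assms(3) E'(1)]) auto
        \<comment> \<open>This set contains all points of \<open>G\<close> that are not good, and
          what remains of \<open>G\<close> after its removal lies in \<open>S\<close>.\<close>
        then have markov: "emeasure (surface E) {x \<in> G. 1 \<le> ennreal (1 / m \<epsilon>) * f x}
            \<le> ennreal (1 / m \<epsilon>) * ennreal (T \<epsilon> * r ^ ?Q)"
          by (intro order_trans[OF nn_integral_Markov_inequality] mult_left_mono) auto
        also have "\<dots> = ennreal (1 / m \<epsilon> * (T \<epsilon> * r ^ ?Q))"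
          using m[OF \<epsilon>] T[OF \<epsilon>] p by (intro ennreal_mult[symmetric]) auto
        also have "1 / m \<epsilon> * (T \<epsilon> * r ^ ?Q) = \<theta> / 2 * r ^ ?Q"
          using T[OF \<epsilon>] assms(2) by (simp add: m_def)
        finally have markov: "emeasure (surface E) {x \<in> G. 1 \<le> ennreal (1 / m \<epsilon>) * f x}
            \<le> ennreal (\<theta> / 2 * r ^ ?Q)" .
        define S where "S = E \<inter> ball p r \<inter> {x. f x \<le> ennreal (m \<epsilon>)}"
        have S: "S \<in> sets borel"
          unfolding S_def f_def using Eb by measurable
        have cover: "G \<subseteq> S \<union> {x \<in> G. 1 \<le> ennreal (1 / m \<epsilon>) * f x}"
        proof
          fix x assume x: "x \<in> G"
          show "x \<in> S \<union> {x \<in> G. 1 \<le> ennreal (1 / m \<epsilon>) * f x}"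
          proof (cases "f x \<le> ennreal (m \<epsilon>)")
            case True
            then show ?thesis using x by (simp add: S_def G_def)
          next
            case False
            have "1 = ennreal (1 / m \<epsilon>) * ennreal (m \<epsilon>)"
              using m[OF \<epsilon>] by (simp add: ennreal_mult[symmetric])
            also have "\<dots> \<le> ennreal (1 / m \<epsilon>) * f x" using False by (intro mult_left_mono) auto
            finally show ?thesis using x by simp
          qed
        qed
        have "ennreal (\<theta> * r ^ ?Q) \<le> emeasure (surface E) G"
          using E'(2) Eb G by (simp add: emeasure_surface) (simp add: G_def Int_assoc[symmetric])
        also have "\<dots> \<le> emeasure (surface E) S + emeasure (surface E) {x \<in> G. 1
            \<le> ennreal (1 / m \<epsilon>) * f x}"
        proof -
          have "{x \<in> G. 1 \<le> ennreal (1 / m \<epsilon>) * f x} =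
              G \<inter> {x \<in> space (surface E). 1 \<le> ennreal (1 / m \<epsilon>) * f x}"
            by auto
          also have "\<dots> \<in> sets (surface E)" by measurable
          finally show ?thesis
            using S by (intro order_trans[OF emeasure_mono[OF cover] emeasure_subadditive]) auto
        qed
        also have "\<dots> \<le> emeasure (surface E) S + ennreal (\<theta> / 2 * r ^ ?Q)"
            by (intro add_left_mono markov)
        finally have "ennreal (\<theta> * r ^ ?Q) - ennreal (\<theta> / 2 * r ^ ?Q) \<le> emeasure (surface E) S"
          by (simp add: ennreal_minus_le_iff add.commute)
        moreover have "ennreal (\<theta> * r ^ ?Q) - ennreal (\<theta> / 2 * r ^ ?Q) = ennreal (\<theta> / 2 * r ^ ?Q)"
          using assms(2) p by (subst ennreal_minus) auto
        moreover have "ennreal (\<eta> * r ^ ?Q) \<le> ennreal (\<theta> / 2 * r ^ ?Q)"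
          using \<eta>(3) p by (intro ennreal_leI mult_right_mono) auto
        ultimately show "ennreal (\<eta> * r ^ ?Q) \<le> emeasure (surface E)
            (E \<inter> ball p r \<inter> {x. scale_measure (W \<inter> scales_below r) x \<le> ennreal (m \<epsilon>)})"
          unfolding S_def f_def by simp
      qed
      \<comment> \<open>The two thresholds meet here: the set to be estimated uses \<epsilon>, while
        \<open>W\<close> was built from \<epsilon> / 2.\<close>
      have "G.transfers (bad_set \<epsilon> E)"
        unfolding G.transfers_def
      proof (intro ballI allI impI)
        fix x q s assume x: "x \<in> E" and q: "(q, s) \<in> bad_set \<epsilon> E" "0 < s" "dist q x \<le> s"
        then have "ennreal (\<epsilon> / 2) < bbeta E x (2 * s)"
          using \<epsilon> by (intro bbeta_transfer) (auto simp: bad_set_def)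
        then have "(x, 2 * s) \<in> bad_set (\<epsilon> / 2) E" using x q by (simp add: bad_set_def)
        then show "(x, 2 * s) \<in> W" unfolding W(2) by simp
      qed
      then show ?thesis
        using G.carleson_estimate[OF bad_set_borel[OF _ cl] _ pr] \<epsilon> by (simp add: \<gamma>_def)
    qed
    then show ?thesis using E by (simp add: BWGL_iff[OF assms(1)])
  qed
  ultimately show ?thesis by blast
qed

end
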